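(* Let $n\ge 1$. Every point $x\in\mathbb{R}^n$ has a neighborhood $V$ such that every closed form with bounded coefficients on $V$ is exact, in the following sense: for every $k>0$ and every $w\in\mathcal{L}^k_\infty(V)$ with $dw=0$ (in the sense of currents) there exists $\theta\in\mathcal{L}^{k-1}_\infty(V)$ with $d\theta=w$ (in the sense of currents). If $k=0$ and $w\in\mathcal{L}^0_\infty(V)$ satisfies $dw=0$ in the sense of currents, then $w$ is a locally constant function.
   Context: For an open set $U\subset\mathbb{R}^n$, a $k$-form on $U$ is an almost everywhere defined map $w:U\to\Lambda^k(\mathbb{R}^n)$, written $w=\sum_{i_1<\dots<i_k}a_{\vec i}\,dx^{\vec i}$; forms that coincide almost everywhere are identified (in particular "locally constant function" is understood up to equality almost everywhere). $\mathcal{L}^k_\infty(U)$ is the space of $k$-forms whose coefficients $a_{\vec i}$ are measurable and essentially bounded on $U$. Let $\mathcal{D}^{j}(U)$ be the space of smooth $j$-forms with compact support in $U$. A $k$-current on $U$ is a continuous linear functional on $\mathcal{D}^{n-k}(U)$; a form $w\in\mathcal{L}^k_\infty(U)$ defines the current $\langle w,\alpha\rangle=\int_U w\wedge\alpha$. The differential of a $k$-current $w$ is the $(k+1)$-current given by $\langle dw,\alpha\rangle=(-1)^{k+1}\langle w,d\alpha\rangle$ for all $\alpha\in\mathcal{D}^{n-k-1}(U)$. Neighborhoods are open. *)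

theory Defs
  imports "HOL-Analysis.Analysis"
begin

text \<open>
  The exterior algebra of \<open>\<real>\<^sup>n\<close> is \<open>real ^ ('n set)\<close>: the component at \<open>I = {i\<^sub>1 < \<dots> < i\<^sub>k}\<close> is the
  coefficient of \<open>dx\<^sub>i\<^sub>1 \<and> \<dots> \<and> dx\<^sub>i\<^sub>k\<close>. The index type is linearly ordered because the order
  of the coordinates fixes these basis elements and the orientation.
\<close>

type_synonym 'n extalg = "real ^ ('n set)"
type_synonym 'n form = "real ^ 'n \<Rightarrow> 'n extalg"

definition ext_power :: "nat \<Rightarrow> 'n::finite extalg set" where
  "ext_power k = {v. \<forall>I. card I \<noteq> k \<longrightarrow> v $ I = 0}"

text \<open>
  For disjoint \<open>I\<close> and \<open>J\<close>, sorting \<open>dx\<^sub>I \<and> dx\<^sub>J\<close> into increasing order takes one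
  transposition for each inversion \<open>(i, j)\<close>, \<open>j < i\<close>; if \<open>I\<close> and \<open>J\<close> meet, the product vanishes.
\<close>

definition wedge_sign :: "'n::{finite,linorder} set \<Rightarrow> 'n set \<Rightarrow> real" where
  "wedge_sign I J = (- 1) ^ card {(i, j). i \<in> I \<and> j \<in> J \<and> j < i}"

definition wedge :: "'n::{finite,linorder} extalg \<Rightarrow> 'n extalg \<Rightarrow> 'n extalg" where
  "wedge v w = (\<chi> K. \<Sum>I\<in>Pow K. wedge_sign I (K - I) * v $ I * w $ (K - I))"

text \<open>
  The space \<open>\<L>\<^sup>k\<^sub>\<infinity>(U)\<close>. A form is represented by a total function; its values outside \<open>U\<close> and on
  null sets are irrelevant.
\<close>

definition Linf_forms :: "(real ^ 'n::finite) set \<Rightarrow> nat \<Rightarrow> 'n form set" where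
  "Linf_forms U k = {w.
     (AE x in lebesgue_on U. w x \<in> ext_power k) \<and>
     (\<forall>I. (\<lambda>x. w x $ I) \<in> borel_measurable (lebesgue_on U) \<and>
          (\<exists>C. AE x in lebesgue_on U. \<bar>w x $ I\<bar> \<le> C))}"

definition partial_deriv ::
    "'n::finite \<Rightarrow> (real ^ 'n \<Rightarrow> 'b::real_normed_vector) \<Rightarrow> real ^ 'n \<Rightarrow> 'b" where
  "partial_deriv i f x = frechet_derivative f (at x) (axis i 1)"

primrec Ck :: "nat \<Rightarrow> (real ^ 'n::finite \<Rightarrow> 'b::real_normed_vector) \<Rightarrow> bool" where
  "Ck 0 f \<longleftrightarrow> continuous_on UNIV f"
| "Ck (Suc m) f \<longleftrightarrow> (\<forall>x. f differentiable (at x)) \<and> (\<forall>i. Ck m (partial_deriv i f))"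

definition smooth :: "(real ^ 'n::finite \<Rightarrow> 'b::real_normed_vector) \<Rightarrow> bool" where
  "smooth f \<longleftrightarrow> (\<forall>m. Ck m f)"

text \<open>
  The space \<open>\<D>\<^sup>j(U)\<close>; a smooth form with compact support in the open set \<open>U\<close> is identified with
  its (smooth) extension by zero to the whole space.
\<close>

definition test_forms :: "(real ^ 'n::finite) set \<Rightarrow> nat \<Rightarrow> 'n form set" where
  "test_forms U j = {\<alpha>. smooth \<alpha> \<and> (\<forall>x. \<alpha> x \<in> ext_power j) \<and>
     compact (closure {x. \<alpha> x \<noteq> 0}) \<and> closure {x. \<alpha> x \<noteq> 0} \<subseteq> U}"

text \<open>\<open>d\<alpha> = \<Sum>\<^sub>i dx\<^sub>i \<and> \<partial>\<^sub>i\<alpha>\<close>\<close>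

definition ext_deriv :: "'n::{finite,linorder} form \<Rightarrow> 'n form" where
  "ext_deriv \<alpha> x = (\<Sum>i\<in>UNIV. wedge (axis {i} 1) (partial_deriv i \<alpha> x))"

text \<open>The integral over \<open>U\<close> of the top-degree part of a form.\<close>

definition form_integral :: "(real ^ 'n::finite) set \<Rightarrow> 'n form \<Rightarrow> real" where
  "form_integral U \<eta> = (LINT x|lebesgue_on U. \<eta> x $ UNIV)"

text \<open>
  Currents are treated as functionals on forms. All currents below are induced by bounded forms
  or are differentials of such, hence are linear and continuous on test forms.
\<close>

type_synonym 'n functional = "'n form \<Rightarrow> real"

definition form_current :: "(real ^ 'n::{finite,linorder}) set \<Rightarrow> 'n form \<Rightarrow> 'n functional" where
  "form_current U w \<alpha> = form_integral U (\<lambda>x. wedge (w x) (\<alpha> x))"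

definition current_diff :: "nat \<Rightarrow> 'n::{finite,linorder} functional \<Rightarrow> 'n functional" where
  "current_diff k T \<alpha> = (- 1) ^ (k + 1) * T (ext_deriv \<alpha>)"

text \<open>
  Equality of \<open>k\<close>-currents on \<open>U\<close>. Writing \<open>j + k = n\<close> instead of \<open>j = n - k\<close> makes the
  condition void for \<open>k > n\<close>, where there are no nonzero test forms.
\<close>

definition current_eq ::
    "(real ^ 'n::finite) set \<Rightarrow> nat \<Rightarrow> 'n functional \<Rightarrow> 'n functional \<Rightarrow> bool" where
  "current_eq U k S T \<longleftrightarrow> (\<forall>j \<alpha>. j + k = CARD('n) \<longrightarrow> \<alpha> \<in> test_forms U j \<longrightarrow> S \<alpha> = T \<alpha>)"

text \<open>\<open>dw = \<omega>\<close> in the sense of currents, for a \<open>k\<close>-form \<open>w\<close> and a \<open>(k+1)\<close>-form \<open>\<omega>\<close>\<close>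

definition has_weak_diff ::
    "(real ^ 'n::{finite,linorder}) set \<Rightarrow> nat \<Rightarrow> 'n form \<Rightarrow> 'n form \<Rightarrow> bool" where
  "has_weak_diff U k w \<omega> \<longleftrightarrow>
     current_eq U (k + 1) (current_diff k (form_current U w)) (form_current U \<omega>)"

definition locally_constant_on :: "('a::topological_space \<Rightarrow> 'b) \<Rightarrow> 'a set \<Rightarrow> bool" where
  "locally_constant_on g U \<longleftrightarrow> (\<forall>x\<in>U. \<exists>W. open W \<and> x \<in> W \<and> W \<subseteq> U \<and> g constant_on W)"

end

theory Submission
  imports Defs
begin

text \<open>
  Take for \<open>V\<close> an open cube around \<open>x\<close>, and for \<open>\<theta>\<close> what the classical cone operator makes
  of \<open>w\<close>: contract \<open>w\<close> with the radial vector field \<open>X = y - x\<close> and average over the dilations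
  \<open>A\<^sub>t y = x + t (y - x)\<close>, that is,
  \<open>\<theta> y = \<integral>\<^sub>0\<^sup>1 t\<^bsup>k-1\<^esup> \<iota>\<^sub>X w (A\<^sub>t y) dt\<close>.
  By Fubini this makes sense for almost every \<open>y\<close> when \<open>w\<close> is merely measurable, and it is bounded
  because \<open>k > 0\<close> and \<open>V\<close> is bounded. No regularisation of \<open>w\<close> is necessary to see that \<open>d\<theta> = w\<close>, since all
  derivatives can be kept on the test form \<open>\<alpha>\<close>. Write \<open>L\<close> for the Lie derivative along \<open>X\<close>.

  \<^item> As \<open>w \<and> d\<alpha>\<close> has degree greater than \<open>n\<close>, the contraction can be moved from \<open>w\<close> to \<open>d\<alpha>\<close> at the
    cost of a sign (\<open>wedge_interior_prod_UNIV\<close>).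
  \<^item> Cartan's formula \<open>\<iota>\<^sub>X d\<alpha> = L\<alpha> - d(\<iota>\<^sub>X \<alpha>)\<close> (\<open>Cartan_formula\<close>) splits the result. The exact part integrates
    to zero: undoing the dilation by a change of variables turns \<open>\<iota>\<^sub>X \<alpha>\<close> into a test form dilated
    towards \<open>x\<close>, which is still supported in \<open>V\<close>, and \<open>w\<close> is closed (\<open>dilation_closed\<close>).
  \<^item> After the same change of variables, \<open>t\<^bsup>k-1\<^esup> \<integral> w (A\<^sub>t y) \<and> L\<alpha>\<close> is minus the derivative in \<open>t\<close> of
    \<open>t\<^sup>k \<integral> w (A\<^sub>t y) \<and> \<alpha>\<close>. The fundamental theorem of calculus leaves the value \<open>\<integral> w \<and> \<alpha>\<close> at \<open>t = 1\<close>;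
    the one at \<open>t = 0\<close> vanishes because of the factor \<open>t\<^sup>k\<close> (\<open>dilation_identity_cone\<close>).

  For \<open>k = 0\<close> the test form has top degree, so \<open>d\<alpha> = 0\<close> and the same computation says that
  \<open>\<integral> w (A\<^sub>t y) \<alpha> y\<close> does not depend on \<open>t\<close>, for dilations about any centre in \<open>V\<close>. Letting \<open>\<alpha>\<close> tend to the
  indicator function of a cube \<open>D\<close>, all cubes inside \<open>D\<close> are seen to carry the same average of \<open>w\<close>, because
  each of them is a dilate of \<open>D\<close>. By Lebesgue's differentiation theorem
  \<open>w\<close> is almost everywhere equal to that average.
\<close>

section \<open>Calculus of smooth functions\<close>

lemma partial_deriv_eq:
  assumes "(f has_derivative f') (at x)"
  shows "partial_deriv i f x = f' (axis i 1)"
  using frechet_derivative_at[OF assms] by (simp add: partial_deriv_def)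

lemma frechet_derivative_eq_sum_partial_deriv:
  fixes f :: "real ^ 'n::finite \<Rightarrow> 'b::real_normed_vector"
  assumes "f differentiable (at x)"
  shows "frechet_derivative f (at x) v = (\<Sum>i\<in>UNIV. v $ i *\<^sub>R partial_deriv i f x)"
proof -
  have lin: "linear (frechet_derivative f (at x))"
    using assms by (rule linear_frechet_derivative)
  have "frechet_derivative f (at x) v = frechet_derivative f (at x) (\<Sum>i\<in>UNIV. v $ i *\<^sub>R axis i 1)"
    using basis_expansion[of v] by (simp add: scalar_mult_eq_scaleR)
  also have "\<dots> = (\<Sum>i\<in>UNIV. v $ i *\<^sub>R partial_deriv i f x)"
    by (simp add: linear_sum[OF lin] linear_scale[OF lin] partial_deriv_def)
  finally show ?thesis .
qed

lemma Ck_Suc_imp_Ck: "Ck (Suc m) f \<Longrightarrow> Ck m f"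
proof (induction m arbitrary: f)
  case 0
  then show ?case
    by (auto intro!: continuous_at_imp_continuous_on differentiable_imp_continuous_within)
next
  case (Suc m)
  then show ?case by (metis Ck.simps(2))
qed

lemma Ck_linear:
  fixes f :: "real ^ 'n::finite \<Rightarrow> 'b::real_normed_vector"
  assumes L: "bounded_linear L"
  shows "Ck m f \<Longrightarrow> Ck m (\<lambda>x. L (f x))"
proof (induction m arbitrary: f)
  case 0
  then show ?case by (simp add: bounded_linear.continuous_on[OF L])
next
  case (Suc m)
  have d: "f differentiable (at x)" for x using Suc.prems by simp
  have D: "((\<lambda>x. L (f x)) has_derivative (\<lambda>v. L (frechet_derivative f (at x) v))) (at x)" for x
    using bounded_linear.has_derivative[OF L d[of x, unfolded frechet_derivative_works]] .
  have "partial_deriv i (\<lambda>x. L (f x)) = (\<lambda>x. L (partial_deriv i f x))" for i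
    using partial_deriv_eq[OF D] by (auto simp: partial_deriv_def)
  then show ?case using Suc D by (auto simp: differentiable_def)
qed

lemma Ck_add: "Ck m f \<Longrightarrow> Ck m g \<Longrightarrow> Ck m (\<lambda>x. f x + g x)"
proof (induction m arbitrary: f g)
  case 0
  then show ?case by (auto intro: continuous_intros)
next
  case (Suc m)
  have d: "f differentiable (at x)" "g differentiable (at x)" for x using Suc.prems by auto
  have D: "((\<lambda>x. f x + g x) has_derivative
    (\<lambda>v. frechet_derivative f (at x) v + frechet_derivative g (at x) v)) (at x)" for x
    using d[unfolded frechet_derivative_works] by (rule has_derivative_add)
  have "partial_deriv i (\<lambda>x. f x + g x) = (\<lambda>x. partial_deriv i f x + partial_deriv i g x)" for i
    using partial_deriv_eq[OF D] by (auto simp: partial_deriv_def)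
  moreover have "(\<lambda>x. f x + g x) differentiable (at x)" for x using D by (auto simp: differentiable_def)
  ultimately show ?case using Suc by auto
qed

lemma partial_deriv_const: "partial_deriv i (\<lambda>x. c) = (\<lambda>x. 0)"
  by (auto intro!: ext partial_deriv_eq[THEN trans])

lemma Ck_const: "Ck m (\<lambda>x. c)"
  by (induction m arbitrary: c) (auto simp: partial_deriv_const)

lemma Ck_sum: "(\<And>a. a \<in> S \<Longrightarrow> Ck m (f a)) \<Longrightarrow> Ck m (\<lambda>x. \<Sum>a\<in>S. f a x)"
  by (induction S rule: infinite_finite_induct) (auto intro: Ck_add Ck_const)

lemma partial_deriv_bilinear:
  fixes f :: "real ^ 'n::finite \<Rightarrow> 'b::real_normed_vector" and g :: "real ^ 'n \<Rightarrow> 'c::real_normed_vector"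
  assumes B: "bounded_bilinear B" and d: "f differentiable (at x)" "g differentiable (at x)"
  shows "(\<lambda>x. B (f x) (g x)) differentiable (at x)"
    "partial_deriv i (\<lambda>x. B (f x) (g x)) x = B (f x) (partial_deriv i g x) + B (partial_deriv i f x) (g x)"
proof -
  note D = bounded_bilinear.FDERIV[OF B d[unfolded frechet_derivative_works]]
  show "(\<lambda>x. B (f x) (g x)) differentiable (at x)" using D by (auto simp: differentiable_def)
  show "partial_deriv i (\<lambda>x. B (f x) (g x)) x = B (f x) (partial_deriv i g x) + B (partial_deriv i f x) (g x)"
    using partial_deriv_eq[OF D] by (simp add: partial_deriv_def)
qed

text \<open>
  The Leibniz rule needs both factors one order below their own regularity as well, which is why
  the class must be known to decrease in the order.
\<close>

lemma Ck_bilinear: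
  assumes B: "bounded_bilinear B"
  shows "Ck m f \<Longrightarrow> Ck m g \<Longrightarrow> Ck m (\<lambda>x. B (f x) (g x))"
proof (induction m arbitrary: f g)
  case 0
  then show ?case by (simp add: bounded_bilinear.continuous_on[OF B])
next
  case (Suc m)
  have d: "f differentiable (at x)" "g differentiable (at x)" for x using Suc.prems by auto
  have "partial_deriv i (\<lambda>x. B (f x) (g x)) =
      (\<lambda>x. B (f x) (partial_deriv i g x) + B (partial_deriv i f x) (g x))" for i
    using partial_deriv_bilinear(2)[OF B d] by auto
  moreover have "Ck m f" "Ck m g" using Suc.prems Ck_Suc_imp_Ck by blast+
  ultimately show ?case
    using Suc partial_deriv_bilinear(1)[OF B d] by (auto intro!: Ck_add)
qed

lemma Ck_mult: "Ck m f \<Longrightarrow> Ck m g \<Longrightarrow> Ck m (\<lambda>x. f x * g x :: real)"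
  by (rule Ck_bilinear[OF bounded_bilinear_mult])

lemma Ck_prod: "(\<And>a. a \<in> S \<Longrightarrow> Ck m (f a)) \<Longrightarrow> Ck m (\<lambda>x. \<Prod>a\<in>S. f a x :: real)"
  by (induction S rule: infinite_finite_induct) (auto intro: Ck_mult Ck_const)

lemma partial_deriv_dilation:
  fixes f :: "real ^ 'n::finite \<Rightarrow> 'b::real_normed_vector"
  assumes "f differentiable (at (p + c *\<^sub>R (x - p)))"
  shows "(\<lambda>x. f (p + c *\<^sub>R (x - p))) differentiable (at x)"
    "partial_deriv i (\<lambda>x. f (p + c *\<^sub>R (x - p))) x = c *\<^sub>R partial_deriv i f (p + c *\<^sub>R (x - p))"
proof -
  let ?D = "frechet_derivative f (at (p + c *\<^sub>R (x - p)))"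
  have "((\<lambda>x. p + c *\<^sub>R (x - p)) has_derivative (\<lambda>v. c *\<^sub>R v)) (at x)"
    by (auto intro!: derivative_eq_intros)
  from diff_chain_at[OF this assms[unfolded frechet_derivative_works]]
  have D: "((\<lambda>x. f (p + c *\<^sub>R (x - p))) has_derivative (\<lambda>v. ?D (c *\<^sub>R v))) (at x)"
    by (simp add: o_def)
  then show "(\<lambda>x. f (p + c *\<^sub>R (x - p))) differentiable (at x)" by (auto simp: differentiable_def)
  show "partial_deriv i (\<lambda>x. f (p + c *\<^sub>R (x - p))) x = c *\<^sub>R partial_deriv i f (p + c *\<^sub>R (x - p))"
    using partial_deriv_eq[OF D, of i] linear_scale[OF linear_frechet_derivative[OF assms]]
    by (simp add: partial_deriv_def)
qed

lemma Ck_dilation: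
  fixes f :: "real ^ 'n::finite \<Rightarrow> 'b::real_normed_vector"
  shows "Ck m f \<Longrightarrow> Ck m (\<lambda>x. f (p + c *\<^sub>R (x - p)))"
proof (induction m arbitrary: f)
  case 0
  then show ?case
    by (auto intro!: continuous_on_compose2[of UNIV f] continuous_intros)
next
  case (Suc m)
  have "partial_deriv i (\<lambda>x. f (p + c *\<^sub>R (x - p))) = (\<lambda>x. c *\<^sub>R partial_deriv i f (p + c *\<^sub>R (x - p)))" for i
    using Suc.prems by (intro ext partial_deriv_dilation) auto
  then show ?case
    using Suc by (auto intro!: partial_deriv_dilation Ck_linear[OF bounded_linear_scaleR_right])
qed

lemma partial_deriv_nth: "partial_deriv i (\<lambda>x. x $ l) = (\<lambda>x. if i = l then 1 else (0::real))"
  by (rule ext, subst partial_deriv_eq[OF bounded_linear.has_derivative[OF bounded_linear_vec_nth has_derivative_ident]])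
     (auto simp: axis_def)

lemma Ck_nth: "Ck m (\<lambda>x::real^'n::finite. x $ l)"
proof (cases m)
  case (Suc m')
  have "(\<lambda>x::real^'n. x $ l) differentiable (at x)" for x
    by (intro bounded_linear_imp_differentiable bounded_linear_vec_nth)
  then show ?thesis by (auto simp: Suc partial_deriv_nth Ck_const)
qed (auto intro: continuous_intros)

lemma Ck_vec_lambda:
  fixes f :: "'a::finite \<Rightarrow> real ^ 'n::finite \<Rightarrow> real"
  assumes "\<And>a. Ck m (f a)"
  shows "Ck m (\<lambda>x. \<chi> a. f a x)"
proof -
  have "(\<lambda>x. \<chi> a. f a x) = (\<lambda>x. \<Sum>a\<in>UNIV. f a x *\<^sub>R axis a 1)"
    by (auto simp: vec_eq_iff axis_def if_distrib cong: if_cong)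
  then show ?thesis
    by (auto intro!: Ck_sum Ck_linear[OF bounded_linear_scaleR_left] assms)
qed

lemma Ck_component:
  fixes f :: "real ^ 'n::finite \<Rightarrow> real ^ 'a::finite"
  shows "Ck m f \<Longrightarrow> Ck m (\<lambda>x. f x $ a)"
  by (rule Ck_linear[OF bounded_linear_vec_nth])

lemma partial_deriv_component:
  fixes f :: "real ^ 'n::finite \<Rightarrow> real ^ 'a::finite"
  assumes "f differentiable (at x)"
  shows "partial_deriv i f x $ a = partial_deriv i (\<lambda>x. f x $ a) x"
  using partial_deriv_eq[OF bounded_linear.has_derivative[OF bounded_linear_vec_nth assms[unfolded frechet_derivative_works]]]
  by (simp add: partial_deriv_def)

lemma smooth_imp_differentiable: "smooth f \<Longrightarrow> f differentiable (at x)"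
  unfolding smooth_def by (metis Ck.simps(2))

lemma smooth_imp_smooth_partial_deriv: "smooth f \<Longrightarrow> smooth (partial_deriv i f)"
  unfolding smooth_def by (metis Ck.simps(2))

lemma smooth_imp_continuous: "smooth f \<Longrightarrow> continuous_on UNIV f"
  unfolding smooth_def by (metis Ck.simps(1))

section \<open>The exterior algebra and Cartan's formula\<close>

lemma wedge_sign_Un_left:
  fixes A B C :: "'n::{finite,linorder} set"
  assumes "A \<inter> B = {}"
  shows "wedge_sign (A \<union> B) C = wedge_sign A C * wedge_sign B C"
proof -
  have "{(i, j). i \<in> A \<union> B \<and> j \<in> C \<and> j < i} =
      {(i, j). i \<in> A \<and> j \<in> C \<and> j < i} \<union> {(i, j). i \<in> B \<and> j \<in> C \<and> j < i}" by auto
  then have "card {(i, j). i \<in> A \<union> B \<and> j \<in> C \<and> j < i} =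
      card {(i, j). i \<in> A \<and> j \<in> C \<and> j < i} + card {(i, j). i \<in> B \<and> j \<in> C \<and> j < i}"
    using assms by (auto intro!: card_Un_disjoint)
  then show ?thesis by (simp add: wedge_sign_def power_add)
qed

lemma wedge_sign_Un_right:
  fixes A B C :: "'n::{finite,linorder} set"
  assumes "A \<inter> B = {}"
  shows "wedge_sign C (A \<union> B) = wedge_sign C A * wedge_sign C B"
proof -
  have "{(i, j). i \<in> C \<and> j \<in> A \<union> B \<and> j < i} =
      {(i, j). i \<in> C \<and> j \<in> A \<and> j < i} \<union> {(i, j). i \<in> C \<and> j \<in> B \<and> j < i}" by auto
  then have "card {(i, j). i \<in> C \<and> j \<in> A \<union> B \<and> j < i} =
      card {(i, j). i \<in> C \<and> j \<in> A \<and> j < i} + card {(i, j). i \<in> C \<and> j \<in> B \<and> j < i}"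
    using assms by (auto intro!: card_Un_disjoint)
  then show ?thesis by (simp add: wedge_sign_def power_add)
qed

text \<open>
  The pairs in \<open>A \<times> B\<close> are split by which entry is larger; one half gives the
  inversions of \<open>(A, B)\<close>, the other those of \<open>(B, A)\<close>.
\<close>

lemma wedge_sign_commute:
  fixes A B :: "'n::{finite,linorder} set"
  assumes "A \<inter> B = {}"
  shows "wedge_sign A B * wedge_sign B A = (- 1) ^ (card A * card B)"
proof -
  let ?S = "{(i, j). i \<in> A \<and> j \<in> B \<and> j < i}" and ?T = "{(i, j). i \<in> A \<and> j \<in> B \<and> i < j}"
  have "card {(i, j). i \<in> B \<and> j \<in> A \<and> j < i} = card ?T"
    by (rule bij_betw_same_card[of prod.swap]) (auto simp: bij_betw_def inj_on_def)
  moreover have disjoint: "?S \<inter> ?T = {}" by auto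
  have "A \<times> B = ?S \<union> ?T" using assms by (auto simp: not_less_iff_gr_or_eq)
  then have "card (A \<times> B) = card ?S + card ?T"
    using card_Un_disjoint[OF finite finite, of ?S ?T] by (metis (no_types, lifting) disjoint)
  ultimately show ?thesis by (simp add: wedge_sign_def power_add card_cartesian_product)
qed

lemma wedge_sign_square: "wedge_sign A B * wedge_sign A B = 1"
  by (simp add: wedge_sign_def flip: power_mult_distrib)

lemma wedge_UNIV:
  "wedge v u $ UNIV = (\<Sum>I\<in>UNIV. wedge_sign I (- I) * v $ I * u $ (- I))"
  by (simp add: wedge_def Compl_eq_Diff_UNIV)

lemma ext_deriv_component:
  "ext_deriv \<alpha> x $ K = (\<Sum>i\<in>K. wedge_sign {i} (K - {i}) * partial_deriv i \<alpha> x $ (K - {i}))"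
proof -
  have "wedge (axis {i} 1) v $ K = (if i \<in> K then wedge_sign {i} (K - {i}) * v $ (K - {i}) else 0)"
    for i v
  proof -
    have "wedge (axis {i} 1) v $ K =
        (\<Sum>I\<in>Pow K. if I = {i} then wedge_sign {i} (K - {i}) * v $ (K - {i}) else 0)"
      unfolding wedge_def vec_lambda_beta by (intro sum.cong) (auto simp: axis_def)
    then show ?thesis by (simp add: sum.delta)
  qed
  then have "ext_deriv \<alpha> x $ K = (\<Sum>i\<in>UNIV. if i \<in> K then wedge_sign {i} (K - {i}) * partial_deriv i \<alpha> x $ (K - {i}) else 0)"
    by (simp add: ext_deriv_def)
  then show ?thesis by (simp add: sum.If_cases)
qed

text \<open>
  The sign is that of contraction in the first slot: \<open>dx\<^sub>i \<and> dx\<^sub>J\<close>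
  contracted with \<open>X\<close> has the coefficient \<open>X\<^sub>i\<close> at
  \<open>J\<close>.
\<close>

definition interior_prod :: "real ^ 'n::{finite,linorder} \<Rightarrow> 'n extalg \<Rightarrow> 'n extalg" where
  "interior_prod X v = (\<chi> J. \<Sum>i\<in>- J. wedge_sign {i} J * X $ i * v $ insert i J)"

lemma interior_prod_ext_power:
  assumes "v \<in> ext_power k"
  shows "interior_prod X v \<in> ext_power (k - 1)"
proof -
  have "v $ insert i J = 0" if "card J \<noteq> k - 1" "i \<notin> J" for i J
    using assms that by (auto simp: ext_power_def card_insert_if)
  then show ?thesis by (auto simp: ext_power_def interior_prod_def intro!: sum.neutral)
qed

text \<open>
  Moving \<open>i\<close> from \<open>K\<close> to its complement. This is the sign that arises
  when a contraction passes from the first factor of a product of top degree to the second.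
\<close>

lemma wedge_sign_shift:
  fixes K :: "'n::{finite,linorder} set"
  assumes i: "i \<in> K"
  shows "wedge_sign (K - {i}) (- (K - {i})) * wedge_sign {i} (K - {i}) =
    (- 1) ^ (card K + 1) * (wedge_sign K (- K) * wedge_sign {i} (- K))"
proof -
  let ?A = "K - {i}"
  have "- ?A = - K \<union> {i}" "- K \<inter> {i} = {}" using i by auto
  then have 1: "wedge_sign ?A (- ?A) = wedge_sign ?A (- K) * wedge_sign ?A {i}"
    by (simp only: wedge_sign_Un_right)
  have "K = ?A \<union> {i}" "?A \<inter> {i} = {}" using i by auto
  then have 2: "wedge_sign K (- K) = wedge_sign ?A (- K) * wedge_sign {i} (- K)"
    by (metis wedge_sign_Un_left)
  have 3: "wedge_sign ?A {i} * wedge_sign {i} ?A = (- 1) ^ card ?A"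
    using wedge_sign_commute[of ?A "{i}"] by simp
  have "card K = Suc (card ?A)" using i by (metis card_Suc_Diff1 finite)
  then have "card K + 1 = card ?A + 2" by arith
  moreover have "(- 1::real) ^ (m + 2) = (- 1) ^ m" for m by simp
  ultimately have 4: "(- 1::real) ^ (card K + 1) = (- 1) ^ card ?A" by metis
  have "a * b * c = e * (a * d * d)" if "b * c = e" "d * d = 1" for a b c d e :: real
  proof -
    have "a * b * c = a * (b * c) * (d * d)" unfolding that(2) by simp
    also have "\<dots> = e * (a * d * d)" unfolding that(1) by simp
    finally show ?thesis .
  qed
  from this[OF 3 wedge_sign_square] show ?thesis unfolding 1 2 4 .
qed

lemma sum_sets_notin_eq_sum_sets_in:
  fixes f :: "'n::finite set \<Rightarrow> 'n \<Rightarrow> 'b::comm_monoid_add"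
  shows "(\<Sum>I\<in>UNIV. \<Sum>i\<in>- I. f I i) = (\<Sum>K\<in>UNIV. \<Sum>i\<in>K. f (K - {i}) i)"
proof -
  have "(\<Sum>I\<in>UNIV. \<Sum>i\<in>- I. f I i) = (\<Sum>(I, i)\<in>(SIGMA I:UNIV. - I). f I i)"
    by (simp add: sum.Sigma)
  also have "\<dots> = (\<Sum>(K, i)\<in>(SIGMA K:UNIV. K). f (K - {i}) i)"
    by (rule sum.reindex_bij_witness[of _ "\<lambda>(K, i). (K - {i}, i)" "\<lambda>(I, i). (insert i I, i)"])
       auto
  also have "\<dots> = (\<Sum>K\<in>UNIV. \<Sum>i\<in>K. f (K - {i}) i)"
    by (simp add: sum.Sigma)
  finally show ?thesis .
qed

text \<open>
  The contraction \<open>\<iota>\<^sub>X\<close> is an antiderivation, and the top coefficient of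
  \<open>\<iota>\<^sub>X (v \<and> u)\<close> is always zero. So the two terms of the product rule
  cancel in top degree. The proof compares coefficients: both sides are sums over pairs \<open>i
  \<in> K\<close> with \<open>card K = k\<close>.
\<close>

lemma wedge_interior_prod_UNIV:
  fixes X :: "real ^ 'n::{finite,linorder}"
  assumes v: "v \<in> ext_power k"
  shows "wedge (interior_prod X v) u $ UNIV = (- 1) ^ (k + 1) * wedge v (interior_prod X u) $ UNIV"
proof -
  have "wedge (interior_prod X v) u $ UNIV =
      (\<Sum>I\<in>UNIV. \<Sum>i\<in>- I. wedge_sign I (- I) * (wedge_sign {i} I * X $ i * v $ insert i I) * u $ (- I))"
    by (simp add: wedge_UNIV interior_prod_def sum_distrib_left sum_distrib_right)
  also have "\<dots> = (\<Sum>K\<in>UNIV. \<Sum>i\<in>K. wedge_sign (K - {i}) (- (K - {i})) *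
      (wedge_sign {i} (K - {i}) * X $ i * v $ insert i (K - {i})) * u $ (- (K - {i})))"
    by (rule sum_sets_notin_eq_sum_sets_in)
  also have "\<dots> = (\<Sum>K\<in>UNIV. \<Sum>i\<in>K. (- 1) ^ (k + 1) *
      (wedge_sign K (- K) * v $ K * (wedge_sign {i} (- K) * X $ i * u $ insert i (- K))))"
  proof (intro sum.cong refl)
    fix K and i :: 'n assume "i \<in> K"
    show "wedge_sign (K - {i}) (- (K - {i})) *
      (wedge_sign {i} (K - {i}) * X $ i * v $ insert i (K - {i})) * u $ (- (K - {i})) =
      (- 1) ^ (k + 1) * (wedge_sign K (- K) * v $ K * (wedge_sign {i} (- K) * X $ i * u $ insert i (- K)))"
    proof (cases "card K = k")
      case True
      have "- (K - {i}) = insert i (- K)" "insert i (K - {i}) = K" using \<open>i \<in> K\<close> by auto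
      moreover have "a * (b * x * y) * z = e * (c * y * (d * x * z))" if "a * b = e * (c * d)" for a b c d e x y z :: real
        using that by algebra
      ultimately show ?thesis using wedge_sign_shift[OF \<open>i \<in> K\<close>] True by metis
    next
      case False
      then have "v $ K = 0" using v by (auto simp: ext_power_def)
      then show ?thesis using \<open>i \<in> K\<close> by (simp add: insert_absorb)
    qed
  qed
  also have "\<dots> = (- 1) ^ (k + 1) * wedge v (interior_prod X u) $ UNIV"
    by (simp add: wedge_UNIV interior_prod_def sum_distrib_left)
  finally show ?thesis .
qed

definition radial_contraction :: "real ^ 'n::{finite,linorder} \<Rightarrow> 'n form \<Rightarrow> 'n form" where
  "radial_contraction p \<alpha> x = interior_prod (x - p) (\<alpha> x)"

lemma Ck_radial_contraction:
  assumes "Ck m \<alpha>"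
  shows "Ck m (radial_contraction p \<alpha>)"
proof -
  have sub: "Ck m (\<lambda>x. (x - p) $ i)" for i
    using Ck_add[OF Ck_nth Ck_const, of m i "- p $ i"] by simp
  have "Ck m (\<lambda>x. \<chi> J. \<Sum>i\<in>- J. wedge_sign {i} J * (x - p) $ i * \<alpha> x $ insert i J)"
    by (intro Ck_vec_lambda Ck_sum Ck_mult Ck_const sub Ck_component[OF assms])
  then show ?thesis by (simp add: radial_contraction_def[abs_def] interior_prod_def)
qed

lemma smooth_radial_contraction: "smooth \<alpha> \<Longrightarrow> smooth (radial_contraction p \<alpha>)"
  by (auto simp: smooth_def Ck_radial_contraction)

lemma partial_deriv_radial_contraction:
  assumes d: "\<alpha> differentiable (at x)"
  shows "partial_deriv l (radial_contraction p \<alpha>) x $ J =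
    (\<Sum>i\<in>- J. wedge_sign {i} J * ((x - p) $ i * partial_deriv l \<alpha> x $ insert i J
       + (if l = i then \<alpha> x $ insert i J else 0)))"
proof -
  let ?D = "frechet_derivative \<alpha> (at x)"
  have D: "((\<lambda>x. \<alpha> x $ a) has_derivative (\<lambda>v. ?D v $ a)) (at x)" for a
    using bounded_linear.has_derivative[OF bounded_linear_vec_nth d[unfolded frechet_derivative_works]] .
  have N: "((\<lambda>x. (x - p) $ i) has_derivative (\<lambda>v. v $ i)) (at x)" for i
    by (auto intro!: derivative_eq_intros bounded_linear.has_derivative[OF bounded_linear_vec_nth] )
  have DJ: "((\<lambda>x. radial_contraction p \<alpha> x $ J) has_derivative
      (\<lambda>v. \<Sum>i\<in>- J. wedge_sign {i} J * ((x - p) $ i * ?D v $ insert i J + v $ i * \<alpha> x $ insert i J))) (at x)" for J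
    unfolding radial_contraction_def interior_prod_def vec_lambda_beta mult.assoc
    by (intro has_derivative_sum has_derivative_mult_right has_derivative_mult N D)
  have "(radial_contraction p \<alpha> has_derivative
      (\<lambda>v. \<chi> J. \<Sum>i\<in>- J. wedge_sign {i} J * ((x - p) $ i * ?D v $ insert i J + v $ i * \<alpha> x $ insert i J))) (at x)"
    by (subst has_derivative_componentwise_within)
       (auto simp: Basis_vec_def inner_axis intro!: DJ[simplified])
  from partial_deriv_eq[OF this, of l] show ?thesis
    by (auto simp: partial_deriv_def axis_def intro!: sum.cong)
qed

text \<open>
  The Lie derivative along the field \<open>x - p\<close>. The flow of this field consists of the
  dilations about \<open>p\<close>, under which each \<open>dx\<^sub>i\<close> scales linearly;
  this produces the term with the degree.
\<close>

definition radial_Lie :: "real ^ 'n::{finite,linorder} \<Rightarrow> 'n form \<Rightarrow> 'n form" where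
  "radial_Lie p \<alpha> x = (\<chi> J. (\<Sum>i\<in>UNIV. (x - p) $ i * partial_deriv i \<alpha> x $ J) + real (card J) * \<alpha> x $ J)"

text \<open>
  With \<open>X = x - p\<close>, the terms \<open>X\<^sub>i \<partial>\<^sub>l \<alpha>\<close>
  with \<open>i \<notin> J\<close>, \<open>l \<in> J\<close> (the \<open>c i l\<close> below)
  occur in both summands with opposite signs. What remains are the diagonal terms \<open>X\<^sub>i
  \<partial>\<^sub>i \<alpha>\<^sub>J\<close>, from the first summand for \<open>i \<notin>
  J\<close> and from the second for \<open>i \<in> J\<close>, and one
  \<open>\<alpha>\<^sub>J\<close> for each \<open>l \<in> J\<close>, where the derivative falls on
  the coefficient \<open>X\<^sub>l\<close>.
\<close>

lemma Cartan_formula: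
  fixes \<alpha> :: "'n::{finite,linorder} form"
  assumes d: "\<alpha> differentiable (at x)"
  shows "interior_prod (x - p) (ext_deriv \<alpha> x) + ext_deriv (radial_contraction p \<alpha>) x = radial_Lie p \<alpha> x"
proof (subst vec_eq_iff, rule allI)
  fix J :: "'n set"
  let ?X = "\<lambda>i. (x - p) $ i" and ?d = "\<lambda>i. partial_deriv i \<alpha> x" and ?s = "\<lambda>i. wedge_sign {i}"
  define c where "c = (\<lambda>i l. ?s l (J - {l}) * ?s i (J - {l}) * ?X i * ?d l $ insert i (J - {l}))"
  have "interior_prod (x - p) (ext_deriv \<alpha> x) $ J =
      (\<Sum>i\<in>- J. ?X i * ?d i $ J - (\<Sum>l\<in>J. c i l))"
    unfolding interior_prod_def vec_lambda_beta
  proof (intro sum.cong refl)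
    fix i assume i: "i \<in> - J"
    have "ext_deriv \<alpha> x $ insert i J = ?s i J * ?d i $ J + (\<Sum>l\<in>J. ?s l (insert i J - {l}) * ?d l $ (insert i J - {l}))"
      unfolding ext_deriv_component using i by (subst sum.insert) (auto)
    moreover have "?s i J * ?X i * (?s i J * ?d i $ J) = ?X i * ?d i $ J"
      using wedge_sign_square[of "{i}" J] by algebra
    moreover have "?s i J * ?X i * (?s l (insert i J - {l}) * ?d l $ (insert i J - {l})) = - c i l" if l: "l \<in> J" for l
    proof -
      have il: "i \<noteq> l" "insert i J - {l} = insert i (J - {l})" using i l by auto
      have "?s i J = ?s i (J - {l}) * ?s i {l}"
        using wedge_sign_Un_right[of "J - {l}" "{l}" "{i}"] l by (simp add: insert_absorb)
      moreover have "?s l (insert i (J - {l})) = ?s l (J - {l}) * ?s l {i}"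
        using wedge_sign_Un_right[of "J - {l}" "{i}" "{l}"] i by simp
      moreover have "?s i {l} * ?s l {i} = - 1" using wedge_sign_commute[of "{i}" "{l}"] il by simp
      ultimately have "?s i J * ?s l (insert i (J - {l})) = - (?s l (J - {l}) * ?s i (J - {l}))"
        by algebra
      then show ?thesis unfolding c_def il by algebra
    qed
    ultimately show "?s i J * ?X i * ext_deriv \<alpha> x $ insert i J = ?X i * ?d i $ J - (\<Sum>l\<in>J. c i l)"
      by (simp add: distrib_left sum_distrib_left sum_negf)
  qed
  moreover have "ext_deriv (radial_contraction p \<alpha>) x $ J = (\<Sum>l\<in>J. ?X l * ?d l $ J + \<alpha> x $ J + (\<Sum>i\<in>- J. c i l))"
    unfolding ext_deriv_component partial_deriv_radial_contraction[OF d]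
  proof (intro sum.cong refl)
    fix l assume l: "l \<in> J"
    have "- (J - {l}) = insert l (- J)" "insert l (J - {l}) = J" using l by auto
    moreover have sq: "?s l (J - {l}) * (?s l (J - {l}) * y) = y" for y
      using wedge_sign_square[of "{l}" "J - {l}"] by algebra
    moreover have "(\<Sum>i\<in>- J. ?s i (J - {l}) * (?X i * ?d l $ insert i (J - {l}) + (if l = i then \<alpha> x $ insert i (J - {l}) else 0)))
       = (\<Sum>i\<in>- J. ?s i (J - {l}) * ?X i * ?d l $ insert i (J - {l}))"
      using l by (intro sum.cong) auto
    ultimately show "?s l (J - {l}) * (\<Sum>i\<in>- (J - {l}). ?s i (J - {l}) *
        (?X i * ?d l $ insert i (J - {l}) + (if l = i then \<alpha> x $ insert i (J - {l}) else 0)))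
      = ?X l * ?d l $ J + \<alpha> x $ J + (\<Sum>i\<in>- J. c i l)"
      using l by (simp only: sum.insert[OF finite] Compl_iff simp_thms distrib_left sum_distrib_left c_def mult.assoc sq)
        (simp add: sq distrib_left sum_distrib_left)
  qed
  moreover have "(\<Sum>i\<in>UNIV. ?X i * ?d i $ J) = (\<Sum>i\<in>- J. ?X i * ?d i $ J) + (\<Sum>i\<in>J. ?X i * ?d i $ J)"
    by (subst sum.union_disjoint[symmetric]) auto
  moreover have "(\<Sum>i\<in>- J. \<Sum>l\<in>J. c i l) = (\<Sum>l\<in>J. \<Sum>i\<in>- J. c i l)" by (rule sum.swap)
  ultimately show "(interior_prod (x - p) (ext_deriv \<alpha> x) + ext_deriv (radial_contraction p \<alpha>) x) $ J = radial_Lie p \<alpha> x $ J"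
    by (simp add: radial_Lie_def sum.distrib sum_subtractf)
qed

section \<open>Dilations of scalar functions\<close>

lemma integral_dilation:
  fixes f :: "'a::euclidean_space \<Rightarrow> real"
  assumes [measurable]: "f \<in> borel_measurable borel" and c: "c > 0"
  shows "(\<integral>x. f (p + c *\<^sub>R (x - p)) \<partial>lborel) = (1 / c) ^ DIM('a) * (\<integral>y. f y \<partial>lborel)"
proof -
  have leb: "(\<integral>y. f y \<partial>lborel) = (\<integral>y. f y \<partial>density (distr lborel borel (\<lambda>x. (p - c *\<^sub>R p) + c *\<^sub>R x)) (\<lambda>_. ennreal (\<bar>c\<bar> ^ DIM('a))))"
    using c by (subst (1) lborel_affine[of c "p - c *\<^sub>R p"]) auto
  have shift: "(\<lambda>x. f ((p - c *\<^sub>R p) + c *\<^sub>R x)) = (\<lambda>x. f (p + c *\<^sub>R (x - p)))"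
    by (simp add: algebra_simps)
  have "(\<integral>y. f y \<partial>lborel) = c ^ DIM('a) * (\<integral>x. f ((p - c *\<^sub>R p) + c *\<^sub>R x) \<partial>lborel)"
    unfolding leb using c by (subst integral_density) (auto simp: integral_distr)
  then show ?thesis using c unfolding shift by (simp add: power_divide)
qed

lemma integrable_bounded_support:
  fixes f :: "'a::euclidean_space \<Rightarrow> real"
  assumes [measurable]: "f \<in> borel_measurable borel" and "\<And>x. \<bar>f x\<bar> \<le> C"
    and "bounded S" "\<And>x. x \<notin> S \<Longrightarrow> f x = 0"
  shows "integrable lborel f"
proof -
  obtain R where R: "S \<subseteq> cball 0 R" using bounded_subset_ballD[OF \<open>bounded S\<close>, of 0] ball_subset_cball by (meson subset_trans)
  show ?thesis
  proof (rule integrableI_bounded_set[where A = "cball 0 R" and B = C])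
    show "emeasure lborel (cball 0 R :: 'a set) < \<infinity>"
      by (rule emeasure_bounded_finite) simp
    show "AE x in lborel. x \<notin> cball 0 R \<longrightarrow> f x = 0"
      using R assms(4) by blast
  qed (use assms in auto)
qed

lemma integrable_bounded_mult:
  fixes f g :: "'a::euclidean_space \<Rightarrow> real"
  assumes "integrable lborel f" "g \<in> borel_measurable borel" "\<And>x. \<bar>g x\<bar> \<le> C"
  shows "integrable lborel (\<lambda>x. g x * f x)"
proof (rule Bochner_Integration.integrable_bound)
  show "integrable lborel (\<lambda>x. C * f x)" using assms by simp
  have "\<bar>g x\<bar> * \<bar>f x\<bar> \<le> \<bar>C\<bar> * \<bar>f x\<bar>" for x
    using assms(3)[of x] by (intro mult_right_mono) auto
  then show "AE x in lborel. norm (g x * f x) \<le> norm (C * f x)" by (simp add: abs_mult)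
qed (use assms in measurable)

lemma continuous_bounded_support_bound:
  fixes f :: "'a::euclidean_space \<Rightarrow> real"
  assumes f: "continuous_on UNIV f" and S: "bounded S" "\<And>x. x \<notin> S \<Longrightarrow> f x = 0"
  obtains M where "\<And>x. \<bar>f x\<bar> \<le> M"
proof -
  have "compact (f ` closure S)"
    using S f by (intro compact_continuous_image continuous_on_subset[OF f]) auto
  then obtain M where M: "\<And>x. x \<in> closure S \<Longrightarrow> \<bar>f x\<bar> \<le> M"
    using compact_imp_bounded bounded_iff by (metis imageI real_norm_def)
  have "\<bar>f x\<bar> \<le> \<bar>M\<bar>" for x
    using M[of x] S(2)[of x] closure_subset[of S] by (cases "x \<in> S") auto
  then show ?thesis using that by blast
qed

text \<open>
  What the Lie derivative along \<open>x - p\<close> does to a single coefficient of a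
  \<open>j\<close>-form.
\<close>

definition Euler_op :: "real ^ 'n \<Rightarrow> nat \<Rightarrow> (real ^ 'n::finite \<Rightarrow> real) \<Rightarrow> real ^ 'n \<Rightarrow> real" where
  "Euler_op p j f x = (\<Sum>i\<in>UNIV. (x - p) $ i * partial_deriv i f x) + real j * f x"

text \<open>
  Pulling back by a dilation multiplies the coefficients of a \<open>j\<close>-form by the
  \<open>j\<close>-th power of the factor. Hence the derivative of the pulled back coefficient in
  the factor is given by the Lie derivative. The factor here is \<open>1 / t\<close>, because the
  dilation by \<open>t\<close> is moved from the bounded form to the smooth one.
\<close>

lemma Euler_op_derivative:
  fixes f :: "real ^ 'n::finite \<Rightarrow> real"
  assumes d: "\<And>x. f differentiable (at x)" and t: "t > 0"
  shows "((\<lambda>t. (1 / t) ^ j * f (p + (1 / t) *\<^sub>R (y - p))) has_real_derivative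
    - ((1 / t) ^ (j + 1)) * Euler_op p j f (p + (1 / t) *\<^sub>R (y - p))) (at t)"
proof -
  define z where "z = p + (1 / t) *\<^sub>R (y - p)"
  have "((\<lambda>t. p + (1 / t) *\<^sub>R (y - p)) has_vector_derivative (- 1 / t\<^sup>2) *\<^sub>R (y - p)) (at t)"
    using t by (auto intro!: derivative_eq_intros simp: has_vector_derivative_def power2_eq_square divide_simps)
  moreover have "(f has_derivative frechet_derivative f (at z)) (at z)"
    using d frechet_derivative_works by blast
  ultimately have "((f \<circ> (\<lambda>t. p + (1 / t) *\<^sub>R (y - p))) has_vector_derivative
      frechet_derivative f (at z) ((- 1 / t\<^sup>2) *\<^sub>R (y - p))) (at t)"
    unfolding z_def by (intro vector_derivative_diff_chain_within) (auto intro: has_derivative_at_withinI)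
  moreover have "frechet_derivative f (at z) ((- 1 / t\<^sup>2) *\<^sub>R (y - p)) =
      - (1 / t) * (\<Sum>i\<in>UNIV. (z - p) $ i * partial_deriv i f z)"
    unfolding frechet_derivative_eq_sum_partial_deriv[OF d]
    using t by (simp add: z_def sum_distrib_left power2_eq_square mult_ac sum_negf)
  ultimately have F: "((\<lambda>t. f (p + (1 / t) *\<^sub>R (y - p))) has_real_derivative
      - (1 / t) * (\<Sum>i\<in>UNIV. (z - p) $ i * partial_deriv i f z)) (at t)"
    by (simp add: o_def has_real_derivative_iff_has_vector_derivative)
  have P: "((\<lambda>t. (1 / t) ^ j) has_real_derivative - (real j * (1 / t) ^ (j + 1))) (at t)"
  proof -
    have "((\<lambda>t. 1 / t) has_real_derivative - ((1 / t) * (1 / t))) (at t)"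
      using t by (auto intro!: derivative_eq_intros)
    from DERIV_power[OF this, of j] show ?thesis by (cases j) (simp_all add: mult_ac)
  qed
  have "((\<lambda>t. (1 / t) ^ j * f (p + (1 / t) *\<^sub>R (y - p))) has_real_derivative
      - (real j * (1 / t) ^ (j + 1)) * f z +
      - (1 / t) * (\<Sum>i\<in>UNIV. (z - p) $ i * partial_deriv i f z) * (1 / t) ^ j) (at t)"
    using DERIV_mult[OF P F] unfolding z_def .
  moreover have "- (real j * (1 / t) ^ (j + 1)) * f z + - (1 / t) * (\<Sum>i\<in>UNIV. (z - p) $ i * partial_deriv i f z) * (1 / t) ^ j
      = - ((1 / t) ^ (j + 1)) * Euler_op p j f z"
    by (simp add: Euler_op_def algebra_simps)
  ultimately show ?thesis unfolding z_def by simp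
qed

lemma integral_Euler_op:
  fixes f :: "real ^ 'n::finite \<Rightarrow> real"
  assumes d: "\<And>x. f differentiable (at x)" and E: "continuous_on UNIV (Euler_op p j f)"
    and e: "0 < e" "e \<le> 1"
  shows "(\<integral>t. indicator {e..1} t * ((1 / t) ^ (j + 1) * Euler_op p j f (p + (1 / t) *\<^sub>R (y - p))) \<partial>lborel) =
    (1 / e) ^ j * f (p + (1 / e) *\<^sub>R (y - p)) - f y"
proof -
  have "(\<integral>t. indicator {e..1} t *\<^sub>R (- ((1 / t) ^ (j + 1)) * Euler_op p j f (p + (1 / t) *\<^sub>R (y - p))) \<partial>lborel) =
      (1 / 1) ^ j * f (p + (1 / 1) *\<^sub>R (y - p)) - (1 / e) ^ j * f (p + (1 / e) *\<^sub>R (y - p))"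
  proof (rule integral_FTC_Icc[OF e(2)])
    fix t assume "e \<le> t" "t \<le> 1"
    then have "t > 0" using e by simp
    from Euler_op_derivative[OF d this, of j p y]
    show "((\<lambda>t. (1 / t) ^ j * f (p + (1 / t) *\<^sub>R (y - p))) has_vector_derivative
      - ((1 / t) ^ (j + 1)) * Euler_op p j f (p + (1 / t) *\<^sub>R (y - p))) (at t within {e..1})"
      by (simp add: has_real_derivative_iff_has_vector_derivative has_vector_derivative_at_within)
  next
    show "continuous_on {e..1} (\<lambda>t. - ((1 / t) ^ (j + 1)) * Euler_op p j f (p + (1 / t) *\<^sub>R (y - p)))"
      using e by (intro continuous_intros continuous_on_compose2[OF E]) auto
  qed
  then have "(\<integral>t. - (indicator {e..1} t * ((1 / t) ^ (j + 1) * Euler_op p j f (p + (1 / t) *\<^sub>R (y - p)))) \<partial>lborel) =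
      f y - (1 / e) ^ j * f (p + (1 / e) *\<^sub>R (y - p))"
    by simp
  then show ?thesis by (simp only: integral_minus minus_equation_iff minus_diff_eq)
qed

text \<open>
  The substitution \<open>y = p + t (x - p)\<close> moves the dilation from \<open>g\<close> to
  \<open>h\<close>. The Jacobian \<open>t\<^bsup>-n\<^esup>\<close> absorbs the weight
  \<open>t\<^sup>k\<close> and leaves \<open>t\<^bsup>-j\<^esup>\<close>, the weight that belongs
  to the \<open>j\<close>-form dilated by \<open>1 / t\<close>.
\<close>

lemma dilation_integral_eq:
  fixes f g :: "real ^ 'n::finite \<Rightarrow> real"
  assumes [measurable]: "g \<in> borel_measurable borel" "h \<in> borel_measurable borel"
    and n: "j + k = CARD('n)" and t: "t > 0"
  shows "t ^ k * (\<integral>x. g (p + t *\<^sub>R (x - p)) * h x \<partial>lborel) =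
    (1 / t) ^ j * (\<integral>y. g y * h (p + (1 / t) *\<^sub>R (y - p)) \<partial>lborel)"
proof -
  have "p + (1 / t) *\<^sub>R ((p + t *\<^sub>R (x - p)) - p) = x" for x
    using t by (simp add: algebra_simps)
  then have "(\<integral>x. g (p + t *\<^sub>R (x - p)) * h x \<partial>lborel) =
      (1 / t) ^ CARD('n) * (\<integral>y. g y * h (p + (1 / t) *\<^sub>R (y - p)) \<partial>lborel)"
    using integral_dilation[of "\<lambda>y. g y * h (p + (1 / t) *\<^sub>R (y - p))" t p] t by simp
  also have "(1 / t) ^ CARD('n) = (1 / t) ^ j * (1 / t) ^ k"
    by (simp add: n[symmetric] power_add)
  finally show ?thesis using t by (simp add: power_divide)
qed

text \<open>
  The two terms on the left are the values at \<open>t = 1\<close> and \<open>t = e\<close> of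
  \<open>t\<^sup>k \<integral> g (p + t (x - p)) f x\<close>. As \<open>g\<close> is only
  measurable, this function of \<open>t\<close> cannot be differentiated as it stands. After the
  substitution the parameter sits in \<open>f\<close> alone, and exchanging the integrals leaves,
  for each \<open>y\<close>, an instance of the fundamental theorem of calculus.
\<close>

lemma dilation_identity:
  fixes f g :: "real ^ 'n::finite \<Rightarrow> real"
  assumes g[measurable]: "g \<in> borel_measurable borel" and gC: "\<And>x. \<bar>g x\<bar> \<le> C"
    and d: "\<And>x. f differentiable (at x)" and E: "continuous_on UNIV (Euler_op p j f)"
    and S: "bounded S" "\<And>x. x \<notin> S \<Longrightarrow> f x = 0" "\<And>x. x \<notin> S \<Longrightarrow> Euler_op p j f x = 0"
    and n: "j + k = CARD('n)" and e: "0 < e" "e \<le> 1"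
  shows "(\<integral>y. g y * f y \<partial>lborel) - e ^ k * (\<integral>x. g (p + e *\<^sub>R (x - p)) * f x \<partial>lborel) =
    - (\<integral>t. indicator {e..1} t * (t ^ k / t * (\<integral>x. g (p + t *\<^sub>R (x - p)) * Euler_op p j f x \<partial>lborel)) \<partial>lborel)"
proof -
  let ?E = "Euler_op p j f"
  have f: "continuous_on UNIV f"
    using d by (simp add: continuous_at_imp_continuous_on differentiable_imp_continuous_within)
  have [measurable]: "f \<in> borel_measurable borel" "?E \<in> borel_measurable borel"
    using f E by (auto intro: borel_measurable_continuous_onI)
  obtain M where M: "\<And>x. \<bar>?E x\<bar> \<le> M" using continuous_bounded_support_bound[OF E S(1,3)] by blast
  obtain M' where M': "\<And>x. \<bar>f x\<bar> \<le> M'" using continuous_bounded_support_bound[OF f S(1,2)] by blast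
  have C: "0 \<le> C" "0 \<le> M" using gC[of 0] M[of 0] by linarith+
  obtain R where R: "S \<subseteq> cball p R" using bounded_subset_ballD[OF S(1), of p] ball_subset_cball by (meson subset_trans)
  define H where "H = (\<lambda>(t, y). indicator {e..1} t * (g y * ((1 / t) ^ (j + 1) * ?E (p + (1 / t) *\<^sub>R (y - p)))))"
  have H[measurable]: "H \<in> borel_measurable (borel \<Otimes>\<^sub>M borel)" unfolding H_def by measurable
  have "integrable lborel H"
  proof (rule integrable_bounded_support)
    show "H \<in> borel_measurable borel" using H by (simp add: borel_prod)
    show "\<bar>H z\<bar> \<le> C * ((1 / e) ^ (j + 1) * M)" for z
    proof (cases "fst z \<in> {e..1}")
      case True
      then have "(1 / fst z) ^ (j + 1) \<le> (1 / e) ^ (j + 1)"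
        using e by (intro power_mono divide_left_mono mult_pos_pos) auto
      then have "\<bar>g (snd z)\<bar> * (\<bar>(1 / fst z) ^ (j + 1)\<bar> * \<bar>?E (p + (1 / fst z) *\<^sub>R (snd z - p))\<bar>) \<le> C * ((1 / e) ^ (j + 1) * M)"
        using True e C by (intro mult_mono gC M) auto
      then show ?thesis using True by (simp add: H_def split_beta abs_mult)
    next
      case False
      then show ?thesis using C e by (simp add: H_def split_beta)
    qed
    \<comment> \<open>For \<open>t \<le> 1\<close> the dilation by \<open>1 / t\<close> moves points away from \<open>p\<close>, so the integrand vanishes outside a ball around \<open>p\<close> that serves all \<open>t\<close>.\<close>
    show "bounded ({e..1} \<times> cball p R)" by (intro bounded_Times) auto
    fix z assume z: "z \<notin> {e..1} \<times> cball p R"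
    show "H z = 0"
    proof (cases "fst z \<in> {e..1}")
      case True
      then have "snd z \<notin> cball p R" using z by (metis mem_Times_iff)
      then have "R < norm (snd z - p)" by (simp add: dist_norm norm_minus_commute)
      also have "norm (snd z - p) \<le> norm (snd z - p) / fst z"
        using True e by (simp add: field_simps mult_left_le_one_le)
      finally have "p + (1 / fst z) *\<^sub>R (snd z - p) \<notin> cball p R"
        using True e by (simp add: dist_norm)
      then have "?E (p + (1 / fst z) *\<^sub>R (snd z - p)) = 0" using R S(3) by blast
      then show ?thesis by (simp add: H_def split_beta)
    qed (simp add: H_def split_beta)
  qed
  then have int: "integrable (lborel \<Otimes>\<^sub>M lborel) H" by (simp add: lborel_prod)
  have "(\<integral>t. indicator {e..1} t * (t ^ k / t * (\<integral>x. g (p + t *\<^sub>R (x - p)) * ?E x \<partial>lborel)) \<partial>lborel) =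
      (\<integral>t. \<integral>y. H (t, y) \<partial>lborel \<partial>lborel)"
  proof (intro Bochner_Integration.integral_cong refl)
    fix t :: real
    show "indicator {e..1} t * (t ^ k / t * (\<integral>x. g (p + t *\<^sub>R (x - p)) * ?E x \<partial>lborel)) = (\<integral>y. H (t, y) \<partial>lborel)"
    proof (cases "t \<in> {e..1}")
      case True
      then have t: "t > 0" using e by simp
      have "t ^ k / t * (\<integral>x. g (p + t *\<^sub>R (x - p)) * ?E x \<partial>lborel) = (1 / t) * (t ^ k * (\<integral>x. g (p + t *\<^sub>R (x - p)) * ?E x \<partial>lborel))"
        by simp
      also have "\<dots> = (1 / t) ^ (j + 1) * (\<integral>y. g y * ?E (p + (1 / t) *\<^sub>R (y - p)) \<partial>lborel)"
        by (subst dilation_integral_eq[OF _ _ n t]) auto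
      also have "\<dots> = (\<integral>y. (1 / t) ^ (j + 1) * (g y * ?E (p + (1 / t) *\<^sub>R (y - p))) \<partial>lborel)" by simp
      finally show ?thesis using True by (simp add: H_def mult_ac)
    qed (simp add: H_def)
  qed
  also have "\<dots> = (\<integral>y. \<integral>t. H (t, y) \<partial>lborel \<partial>lborel)"
    using lborel_pair.Fubini_integral[of "\<lambda>t y. H (t, y)"] int by (simp add: case_prod_eta)
  also have "\<dots> = (\<integral>y. g y * ((1 / e) ^ j * f (p + (1 / e) *\<^sub>R (y - p)) - f y) \<partial>lborel)"
  proof (intro Bochner_Integration.integral_cong refl)
    fix y
    have "(\<integral>t. H (t, y) \<partial>lborel) = (\<integral>t. g y * (indicator {e..1} t * ((1 / t) ^ (j + 1) * ?E (p + (1 / t) *\<^sub>R (y - p)))) \<partial>lborel)"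
      by (intro Bochner_Integration.integral_cong refl) (simp add: H_def mult_ac)
    then show "(\<integral>t. H (t, y) \<partial>lborel) = g y * ((1 / e) ^ j * f (p + (1 / e) *\<^sub>R (y - p)) - f y)"
      by (simp only: integral_mult_right_zero integral_Euler_op[OF d E e])
  qed
  also have "\<dots> = (1 / e) ^ j * (\<integral>y. g y * f (p + (1 / e) *\<^sub>R (y - p)) \<partial>lborel) - (\<integral>y. g y * f y \<partial>lborel)"
  proof -
    have 1: "integrable lborel (\<lambda>y. g y * f y)"
      by (rule integrable_bounded_mult[OF integrable_bounded_support[OF _ M' S(1,2)] g gC]) auto
    have 2: "integrable lborel (\<lambda>y. g y * f (p + (1 / e) *\<^sub>R (y - p)))"
    proof (rule integrable_bounded_mult[OF integrable_bounded_support[where S = "cball p R"] g gC])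
      fix y assume "y \<notin> cball p R"
      then have "R < norm (y - p)" by (simp add: dist_norm norm_minus_commute)
      also have "norm (y - p) \<le> norm (y - p) / e"
        using e by (simp add: field_simps mult_left_le_one_le)
      finally have "p + (1 / e) *\<^sub>R (y - p) \<notin> cball p R"
        using e by (simp add: dist_norm)
      then show "f (p + (1 / e) *\<^sub>R (y - p)) = 0" using R S(2) by blast
    qed (use M' in auto)
    have "(\<integral>y. g y * ((1 / e) ^ j * f (p + (1 / e) *\<^sub>R (y - p)) - f y) \<partial>lborel) =
        (\<integral>y. (1 / e) ^ j * (g y * f (p + (1 / e) *\<^sub>R (y - p))) - g y * f y \<partial>lborel)"
      by (simp add: algebra_simps)
    also have "\<dots> = (1 / e) ^ j * (\<integral>y. g y * f (p + (1 / e) *\<^sub>R (y - p)) \<partial>lborel) - (\<integral>y. g y * f y \<partial>lborel)"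
      using 1 2 by (subst Bochner_Integration.integral_diff) auto
    finally show ?thesis .
  qed
  also have "\<dots> = e ^ k * (\<integral>x. g (p + e *\<^sub>R (x - p)) * f x \<partial>lborel) - (\<integral>y. g y * f y \<partial>lborel)"
    by (subst dilation_integral_eq[OF _ _ n e(1)]) auto
  finally show ?thesis by simp
qed

text \<open>
  Let \<open>e\<close> tend to \<open>0\<close> in the preceding identity: the integrals over
  \<open>x\<close> are bounded uniformly in the dilation, so the factor \<open>e\<^sup>k\<close>
  with \<open>k > 0\<close> makes the second term on the left vanish.
\<close>

lemma dilation_identity_cone:
  fixes f g :: "real ^ 'n::finite \<Rightarrow> real"
  assumes g[measurable]: "g \<in> borel_measurable borel" and gC: "\<And>x. \<bar>g x\<bar> \<le> C"
    and d: "\<And>x. f differentiable (at x)" and E: "continuous_on UNIV (Euler_op p j f)"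
    and S: "bounded S" "\<And>x. x \<notin> S \<Longrightarrow> f x = 0" "\<And>x. x \<notin> S \<Longrightarrow> Euler_op p j f x = 0"
    and n: "j + k = CARD('n)" and k: "k > 0"
  shows "(\<integral>y. g y * f y \<partial>lborel) =
    - (\<integral>t. indicator {0<..1} t * (t ^ (k - 1) * (\<integral>x. g (p + t *\<^sub>R (x - p)) * Euler_op p j f x \<partial>lborel)) \<partial>lborel)"
proof -
  let ?E = "Euler_op p j f"
  define I where "I t = (\<integral>x. g (p + t *\<^sub>R (x - p)) * ?E x \<partial>lborel)" for t
  define G where "G t = (\<integral>x. g (p + t *\<^sub>R (x - p)) * f x \<partial>lborel)" for t
  have f: "continuous_on UNIV f"
    using d by (simp add: continuous_at_imp_continuous_on differentiable_imp_continuous_within)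
  have [measurable]: "f \<in> borel_measurable borel" "?E \<in> borel_measurable borel"
    using f E by (auto intro: borel_measurable_continuous_onI)
  have C0: "0 \<le> C" using gC[of 0] by linarith
  have bound: "\<exists>M. \<forall>t. \<bar>\<integral>x. g (p + t *\<^sub>R (x - p)) * h x \<partial>lborel\<bar> \<le> M"
    if h: "continuous_on UNIV h" "\<And>x. x \<notin> S \<Longrightarrow> h x = 0" for h :: "real ^ 'n \<Rightarrow> real"
  proof -
    have hm[measurable]: "h \<in> borel_measurable borel" using h by (auto intro: borel_measurable_continuous_onI)
    obtain M where M: "\<And>x. \<bar>h x\<bar> \<le> M" using continuous_bounded_support_bound[OF h(1) S(1) h(2)] by blast
    have hi: "integrable lborel h" by (rule integrable_bounded_support[OF hm M S(1) h(2)])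
    have "\<bar>\<integral>x. g (p + t *\<^sub>R (x - p)) * h x \<partial>lborel\<bar> \<le> (\<integral>x. C * \<bar>h x\<bar> \<partial>lborel)" for t
    proof -
      have "\<bar>\<integral>x. g (p + t *\<^sub>R (x - p)) * h x \<partial>lborel\<bar> \<le> (\<integral>x. \<bar>g (p + t *\<^sub>R (x - p)) * h x\<bar> \<partial>lborel)"
        by (rule integral_abs_bound)
      also have "\<dots> \<le> (\<integral>x. C * \<bar>h x\<bar> \<partial>lborel)"
        using hi by (intro integral_mono integrable_abs integrable_bounded_mult[where C = C])
          (auto simp: abs_mult gC C0 intro!: mult_right_mono)
      finally show ?thesis .
    qed
    then show ?thesis by blast
  qed
  obtain MI where MI: "\<And>t. \<bar>I t\<bar> \<le> MI" using bound[OF E S(3)] unfolding I_def by blast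
  obtain MG where MG: "\<And>t. \<bar>G t\<bar> \<le> MG" using bound[OF f S(2)] unfolding G_def by blast
  have MI0: "0 \<le> MI" using MI[of 0] by linarith
  have [measurable]: "I \<in> borel_measurable borel" unfolding I_def by measurable
  define e where "e m = 1 / real (Suc m)" for m
  have e: "0 < e m" "e m \<le> 1" for m by (auto simp: e_def)
  have e0: "e \<longlonglongrightarrow> 0" unfolding e_def by (rule LIMSEQ_Suc[OF lim_1_over_n])
  have eq: "(\<integral>y. g y * f y \<partial>lborel) - e m ^ k * G (e m) =
      - (\<integral>t. indicator {e m..1} t * (t ^ (k - 1) * I t) \<partial>lborel)" for m
  proof -
    have "(\<integral>y. g y * f y \<partial>lborel) - e m ^ k * G (e m) =
      - (\<integral>t. indicator {e m..1} t * (t ^ k / t * I t) \<partial>lborel)"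
      unfolding G_def I_def by (rule dilation_identity[OF g gC d E S n e])
    also have "(\<lambda>t. indicator {e m..1} t * (t ^ k / t * I t)) = (\<lambda>t. indicator {e m..1} t * (t ^ (k - 1) * I t))"
      using k e[of m] by (cases k) (auto simp: fun_eq_iff split: split_indicator)
    finally show ?thesis .
  qed
  have "(\<lambda>m. e m ^ k * G (e m)) \<longlonglongrightarrow> 0"
  proof (rule Lim_null_comparison)
    show "\<forall>\<^sub>F m in sequentially. norm (e m ^ k * G (e m)) \<le> e m ^ k * MG"
    proof (rule always_eventually, rule allI)
      fix m
      have "e m ^ k * \<bar>G (e m)\<bar> \<le> e m ^ k * MG" using e(1)[of m] by (intro mult_left_mono MG) simp
      then show "norm (e m ^ k * G (e m)) \<le> e m ^ k * MG" using e(1)[of m] by (simp add: abs_mult)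
    qed
    show "(\<lambda>m. e m ^ k * MG) \<longlonglongrightarrow> 0"
      using tendsto_mult[OF tendsto_power[OF e0, of k] tendsto_const[of MG]] k by (simp add: power_0_left)
  qed
  then have "(\<lambda>m. (\<integral>y. g y * f y \<partial>lborel) - e m ^ k * G (e m)) \<longlonglongrightarrow> (\<integral>y. g y * f y \<partial>lborel)"
    using tendsto_diff[OF tendsto_const] by fastforce
  moreover have "(\<lambda>m. - (\<integral>t. indicator {e m..1} t * (t ^ (k - 1) * I t) \<partial>lborel)) \<longlonglongrightarrow>
      - (\<integral>t. indicator {0<..1} t * (t ^ (k - 1) * I t) \<partial>lborel)"
  proof (intro tendsto_minus integral_dominated_convergence[where w = "\<lambda>t. indicator {0..1} t * MI"])
    show "integrable lborel (\<lambda>t. indicator {0..1::real} t * MI)"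
      by (intro integrable_mult_left integrable_real_indicator) auto
    show "AE t in lborel. (\<lambda>m. indicator {e m..1} t * (t ^ (k - 1) * I t)) \<longlonglongrightarrow> indicator {0<..1} t * (t ^ (k - 1) * I t)"
    proof (rule AE_I2)
      fix t :: real
      have "\<forall>\<^sub>F m in sequentially. indicator {e m..1} t * (t ^ (k - 1) * I t) = indicator {0<..1} t * (t ^ (k - 1) * I t)"
      proof (cases "t > 0")
        case True
        then have "\<forall>\<^sub>F m in sequentially. e m < t" using e0 by (simp add: order_tendsto_iff)
        then show ?thesis by eventually_elim (use True in \<open>auto split: split_indicator\<close>)
      next
        case False
        then have "t \<notin> {e m..1}" for m using e(1)[of m] by auto
        then show ?thesis using False by simp
      qed
      then show "(\<lambda>m. indicator {e m..1} t * (t ^ (k - 1) * I t)) \<longlonglongrightarrow> indicator {0<..1} t * (t ^ (k - 1) * I t)"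
        by (rule tendsto_eventually)
    qed
    fix m
    show "AE t in lborel. norm (indicator {e m..1} t * (t ^ (k - 1) * I t)) \<le> indicator {0..1} t * MI"
    proof (rule AE_I2)
      fix t :: real
      show "norm (indicator {e m..1} t * (t ^ (k - 1) * I t)) \<le> indicator {0..1} t * MI"
      proof (cases "t \<in> {e m..1}")
        case True
        then have t: "0 \<le> t" "t \<le> 1" using e(1)[of m] by auto
        then have "\<bar>t ^ (k - 1)\<bar> * \<bar>I t\<bar> \<le> 1 * MI"
          by (intro mult_mono MI) (auto simp: power_le_one)
        then show ?thesis using True t by (simp add: abs_mult)
      qed (use MI0 in simp)
    qed
  qed measurable
  ultimately show ?thesis
    unfolding eq I_def by (rule LIMSEQ_unique)
qed

section \<open>The cone operator\<close>

text \<open>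
  The weight belongs to the contraction of a \<open>k\<close>-form with the radial field: its
  pull-back by the dilation by \<open>t\<close> scales with \<open>t\<^sup>k\<close>, and the
  field absorbs one factor. The interval omits \<open>0\<close>, where the dilation is constant.
\<close>

definition cone_average :: "real ^ 'n \<Rightarrow> nat \<Rightarrow> (real ^ 'n \<Rightarrow> real) \<Rightarrow> real ^ 'n \<Rightarrow> real" where
  "cone_average p k g x = (\<integral>t. indicator {0<..1} t * (t ^ (k - 1) * g (p + t *\<^sub>R (x - p))) \<partial>lborel)"

lemma indicator_power_bound:
  fixes t :: real
  assumes "\<bar>y\<bar> \<le> C"
  shows "\<bar>indicator {0<..1} t * (t ^ m * y)\<bar> \<le> indicator {0<..1} t * C"
proof -
  have "t ^ m * \<bar>y\<bar> \<le> 1 * C" if "0 < t" "t \<le> 1"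
    using that assms by (intro mult_mono power_le_one) auto
  then show ?thesis by (auto simp: abs_mult split: split_indicator)
qed

lemma cone_average_measurable:
  assumes [measurable]: "g \<in> borel_measurable borel"
  shows "cone_average p k g \<in> borel_measurable borel"
  unfolding cone_average_def by measurable

lemma cone_average_bound:
  assumes [measurable]: "g \<in> borel_measurable borel" and C: "\<And>x. \<bar>g x\<bar> \<le> C"
  shows "\<bar>cone_average p k g x\<bar> \<le> C"
proof -
  have C0: "0 \<le> C" using C[of 0] by linarith
  have "\<bar>cone_average p k g x\<bar> \<le> (\<integral>t. \<bar>indicator {0<..1} t * (t ^ (k - 1) * g (p + t *\<^sub>R (x - p)))\<bar> \<partial>lborel)"
    unfolding cone_average_def by (rule integral_abs_bound)
  also have "\<dots> \<le> (\<integral>t. indicator {0<..1::real} t * C \<partial>lborel)"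
  proof (rule integral_mono)
    show int: "integrable lborel (\<lambda>t. indicator {0<..1::real} t * C)"
      by (intro integrable_mult_left integrable_real_indicator) auto
    show "integrable lborel (\<lambda>t. \<bar>indicator {0<..1} t * (t ^ (k - 1) * g (p + t *\<^sub>R (x - p)))\<bar>)"
    proof (rule Bochner_Integration.integrable_bound[OF int])
      show "AE t in lborel. norm \<bar>indicator {0<..1} t * (t ^ (k - 1) * g (p + t *\<^sub>R (x - p)))\<bar> \<le> norm (indicator {0<..1} t * C)"
        using indicator_power_bound[OF C, of _ "k - 1"] C0 by (simp add: abs_mult)
    qed measurable
  qed (intro indicator_power_bound C)
  also have "\<dots> = C" by simp
  finally show ?thesis .
qed

lemma cone_average_Fubini:
  fixes g h :: "real ^ 'n::finite \<Rightarrow> real"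
  assumes [measurable]: "g \<in> borel_measurable borel" "h \<in> borel_measurable borel"
    and gC: "\<And>x. \<bar>g x\<bar> \<le> C" and hM: "\<And>x. \<bar>h x\<bar> \<le> M" and S: "bounded S" "\<And>x. x \<notin> S \<Longrightarrow> h x = 0"
  shows "integrable lborel (\<lambda>t. indicator {0<..1} t * (t ^ (k - 1) * (\<integral>x. g (p + t *\<^sub>R (x - p)) * h x \<partial>lborel)))"
    "(\<integral>x. cone_average p k g x * h x \<partial>lborel) =
      (\<integral>t. indicator {0<..1} t * (t ^ (k - 1) * (\<integral>x. g (p + t *\<^sub>R (x - p)) * h x \<partial>lborel)) \<partial>lborel)"
proof -
  define H where "H = (\<lambda>(t, x). indicator {0<..1::real} t * (t ^ (k - 1) * (g (p + t *\<^sub>R (x - p)) * h x)))"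
  have H[measurable]: "H \<in> borel_measurable (borel \<Otimes>\<^sub>M borel)" unfolding H_def by measurable
  have "integrable lborel H"
  proof (rule integrable_bounded_support)
    show "H \<in> borel_measurable borel" using H by (simp add: borel_prod)
    show "bounded ({0<..1::real} \<times> S)"
      using S(1) by (intro bounded_Times) (auto intro: bounded_subset[of "{0..1::real}"])
    fix z :: "real \<times> (real ^ 'n)"
    have "\<bar>g y * h (snd z)\<bar> \<le> C * M" for y
      unfolding abs_mult using gC[of y] hM[of "snd z"] by (intro mult_mono) auto
    from indicator_power_bound[OF this[of "p + fst z *\<^sub>R (snd z - p)"], of "fst z" "k - 1"]
    have "\<bar>H z\<bar> \<le> indicator {0<..1} (fst z) * (C * M)" by (simp add: H_def split_beta)
    also have "\<dots> \<le> C * M" using gC[of 0] hM[of 0] by (auto split: split_indicator)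
    finally show "\<bar>H z\<bar> \<le> C * M" .
    show "z \<notin> {0<..1} \<times> S \<Longrightarrow> H z = 0" using S by (cases z) (auto simp: H_def)
  qed
  then have int: "integrable (lborel \<Otimes>\<^sub>M lborel) H" by (simp add: lborel_prod)
  have 1: "(\<integral>x. H (t, x) \<partial>lborel) = indicator {0<..1} t * (t ^ (k - 1) * (\<integral>x. g (p + t *\<^sub>R (x - p)) * h x \<partial>lborel))" for t
    by (simp add: H_def)
  have "(\<integral>t. H (t, x) \<partial>lborel) = (\<integral>t. indicator {0<..1} t * (t ^ (k - 1) * g (p + t *\<^sub>R (x - p))) * h x \<partial>lborel)" for x
    by (simp add: H_def mult.assoc)
  then have 2: "(\<integral>t. H (t, x) \<partial>lborel) = cone_average p k g x * h x" for x
    by (simp only: integral_mult_left_zero cone_average_def)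
  have "integrable lborel (\<lambda>t. \<integral>x. H (t, x) \<partial>lborel)"
    using lborel_pair.integrable_fst[of "\<lambda>t x. H (t, x)"] int by (simp add: case_prod_eta)
  then show "integrable lborel (\<lambda>t. indicator {0<..1} t * (t ^ (k - 1) * (\<integral>x. g (p + t *\<^sub>R (x - p)) * h x \<partial>lborel)))"
    by (simp only: 1)
  have "(\<integral>x. \<integral>t. H (t, x) \<partial>lborel \<partial>lborel) = (\<integral>t. \<integral>x. H (t, x) \<partial>lborel \<partial>lborel)"
    using lborel_pair.Fubini_integral[of "\<lambda>t x. H (t, x)"] int by (simp add: case_prod_eta)
  then show "(\<integral>x. cone_average p k g x * h x \<partial>lborel) =
      (\<integral>t. indicator {0<..1} t * (t ^ (k - 1) * (\<integral>x. g (p + t *\<^sub>R (x - p)) * h x \<partial>lborel)) \<partial>lborel)"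
    by (simp only: 1 2)
qed

text \<open>
  Borel measurable and bounded everywhere, rather than up to null sets. The cone operator
  evaluates \<open>w\<close> along rays, and joint measurability in the point and the dilation
  factor is immediate for Borel functions.
\<close>

definition bounded_Borel_form :: "'n::finite form \<Rightarrow> bool" where
  "bounded_Borel_form w \<longleftrightarrow>
    (\<forall>I. (\<lambda>x. w x $ I) \<in> borel_measurable borel \<and> (\<exists>C. \<forall>x. \<bar>w x $ I\<bar> \<le> C))"

text \<open>
  The regularity that remains of a test form after one differentiation, and all that the pairing
  with a bounded form uses.
\<close>

definition compact_support_form :: "'n::finite form \<Rightarrow> bool" where
  "compact_support_form u \<longleftrightarrow>
    (\<forall>I. continuous_on UNIV (\<lambda>x. u x $ I)) \<and> (\<exists>S. bounded S \<and> (\<forall>x. x \<notin> S \<longrightarrow> u x = 0))"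

lemma integrable_pairing:
  assumes "bounded_Borel_form w" "compact_support_form u"
  shows "integrable lborel (\<lambda>x. w x $ I * u x $ J)"
proof -
  obtain S where S: "bounded S" "\<And>x. x \<notin> S \<Longrightarrow> u x $ J = 0" and c: "continuous_on UNIV (\<lambda>x. u x $ J)"
    using assms(2) unfolding compact_support_form_def by (metis zero_index)
  obtain M where "\<And>x. \<bar>u x $ J\<bar> \<le> M" using continuous_bounded_support_bound[OF c S] by blast
  then have "integrable lborel (\<lambda>x. u x $ J)"
    by (rule integrable_bounded_support[OF borel_measurable_continuous_onI[OF c] _ S])
  then show ?thesis
    using assms(1) integrable_bounded_mult[of _ "\<lambda>x. w x $ I"] unfolding bounded_Borel_form_def by blast
qed

lemma integrable_wedge:
  assumes "bounded_Borel_form w" "compact_support_form u"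
  shows "integrable lborel (\<lambda>x. wedge (w x) (u x) $ UNIV)"
proof -
  have "integrable lborel (\<lambda>x. wedge_sign I (- I) * (w x $ I * u x $ (- I)))" for I
    by (intro integrable_mult_right integrable_pairing assms)
  then show ?thesis unfolding wedge_UNIV mult.assoc by (intro Bochner_Integration.integrable_sum)
qed

lemma integral_wedge:
  assumes "bounded_Borel_form w" "compact_support_form u"
  shows "(\<integral>x. wedge (w x) (u x) $ UNIV \<partial>lborel) =
    (\<Sum>I\<in>UNIV. wedge_sign I (- I) * (\<integral>x. w x $ I * u x $ (- I) \<partial>lborel))"
proof -
  have "integrable lborel (\<lambda>x. wedge_sign I (- I) * (w x $ I * u x $ (- I)))" for I
    by (intro integrable_mult_right integrable_pairing assms)
  then show ?thesis unfolding wedge_UNIV mult.assoc by (subst Bochner_Integration.integral_sum) auto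
qed

lemma partial_deriv_eq_0_outside_support:
  assumes "x \<notin> closure {x. f x \<noteq> 0}"
  shows "partial_deriv i f x = 0"
proof -
  have "open (- closure {x. f x \<noteq> 0})" by auto
  then have "(f has_derivative (\<lambda>_. 0)) (at x)"
    using assms closure_subset[of "{x. f x \<noteq> 0}"]
    by (intro has_derivative_transform_within_open[OF has_derivative_const[of 0]]) auto
  then show ?thesis using partial_deriv_eq by fastforce
qed

lemma smooth_imp_continuous_component:
  "smooth \<alpha> \<Longrightarrow> continuous_on UNIV (\<lambda>x. \<alpha> x $ J)"
  "smooth \<alpha> \<Longrightarrow> continuous_on UNIV (\<lambda>x. partial_deriv i \<alpha> x $ J)"
  by (intro continuous_intros smooth_imp_continuous smooth_imp_smooth_partial_deriv; assumption)+

lemma compact_support_ext_deriv: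
  assumes "smooth \<alpha>" "bounded {x. \<alpha> x \<noteq> 0}"
  shows "compact_support_form (ext_deriv \<alpha>)"
  unfolding compact_support_form_def
proof (intro conjI allI exI[of _ "closure {x. \<alpha> x \<noteq> 0}"] impI)
  show "continuous_on UNIV (\<lambda>x. ext_deriv \<alpha> x $ I)" for I
    unfolding ext_deriv_component by (intro continuous_intros smooth_imp_continuous_component assms)
  show "x \<notin> closure {x. \<alpha> x \<noteq> 0} \<Longrightarrow> ext_deriv \<alpha> x = 0" for x
    by (simp add: vec_eq_iff ext_deriv_component partial_deriv_eq_0_outside_support)
qed (use assms in auto)

lemma compact_support_radial_Lie:
  assumes "smooth \<alpha>" "bounded {x. \<alpha> x \<noteq> 0}"
  shows "compact_support_form (radial_Lie p \<alpha>)"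
  unfolding compact_support_form_def
proof (intro conjI allI exI[of _ "closure {x. \<alpha> x \<noteq> 0}"] impI)
  show "continuous_on UNIV (\<lambda>x. radial_Lie p \<alpha> x $ I)" for I
    unfolding radial_Lie_def vec_lambda_beta by (intro continuous_intros smooth_imp_continuous_component assms)
  show "x \<notin> closure {x. \<alpha> x \<noteq> 0} \<Longrightarrow> radial_Lie p \<alpha> x = 0" for x
    using closure_subset[of "{x. \<alpha> x \<noteq> 0}"]
    by (auto simp add: vec_eq_iff radial_Lie_def partial_deriv_eq_0_outside_support)
qed (use assms in auto)

lemma compact_support_smooth:
  assumes "smooth \<alpha>" "bounded {x. \<alpha> x \<noteq> 0}"
  shows "compact_support_form \<alpha>"
  unfolding compact_support_form_def using assms smooth_imp_continuous_component by blast

definition cone_form :: "real ^ 'n \<Rightarrow> nat \<Rightarrow> 'n::finite form \<Rightarrow> 'n form" where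
  "cone_form p k w x = (\<chi> K. cone_average p k (\<lambda>y. w y $ K) x)"

lemma cone_form_ext_power:
  assumes "\<And>y. w y \<in> ext_power k"
  shows "cone_form p k w x \<in> ext_power k"
  using assms by (simp add: ext_power_def cone_form_def cone_average_def)

lemma bounded_Borel_cone_form:
  assumes "bounded_Borel_form w"
  shows "bounded_Borel_form (cone_form p k w)"
  using assms unfolding bounded_Borel_form_def cone_form_def vec_lambda_beta
  by (metis cone_average_measurable cone_average_bound)

lemma bounded_Borel_dilation:
  assumes "bounded_Borel_form w"
  shows "bounded_Borel_form (\<lambda>x. w (p + t *\<^sub>R (x - p)))"
proof -
  have "(\<lambda>x. w (p + t *\<^sub>R (x - p)) $ I) \<in> borel_measurable borel" for I
  proof -
    have [measurable]: "(\<lambda>x. w x $ I) \<in> borel_measurable borel"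
      using assms by (simp add: bounded_Borel_form_def)
    show ?thesis by (rule measurable_compose[of "\<lambda>x. p + t *\<^sub>R (x - p)" _ borel "\<lambda>x. w x $ I"]) measurable
  qed
  then show ?thesis using assms unfolding bounded_Borel_form_def by blast
qed

lemma cone_form_Fubini:
  assumes w: "bounded_Borel_form w" and u: "compact_support_form u"
  shows "(\<integral>x. wedge (cone_form p k w x) (u x) $ UNIV \<partial>lborel) =
    (\<integral>t. indicator {0<..1} t * (t ^ (k - 1) * (\<integral>x. wedge (w (p + t *\<^sub>R (x - p))) (u x) $ UNIV \<partial>lborel)) \<partial>lborel)"
proof -
  let ?F = "\<lambda>I t. indicator {0<..1} t * (t ^ (k - 1) * (\<integral>x. w (p + t *\<^sub>R (x - p)) $ I * u x $ (- I) \<partial>lborel))"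
  have *: "integrable lborel (?F I)"
    "(\<integral>x. cone_form p k w x $ I * u x $ (- I) \<partial>lborel) = (\<integral>t. ?F I t \<partial>lborel)" for I
  proof -
    obtain S where S: "bounded S" "\<And>x. x \<notin> S \<Longrightarrow> u x $ (- I) = 0" and c: "continuous_on UNIV (\<lambda>x. u x $ (- I))"
      using u unfolding compact_support_form_def by (metis zero_index)
    obtain M where M: "\<And>x. \<bar>u x $ (- I)\<bar> \<le> M" using continuous_bounded_support_bound[OF c S] by blast
    obtain C where C: "\<And>x. \<bar>w x $ I\<bar> \<le> C" and m: "(\<lambda>x. w x $ I) \<in> borel_measurable borel"
      using w by (auto simp: bounded_Borel_form_def)
    note * = cone_average_Fubini[OF m borel_measurable_continuous_onI[OF c] C M S, where k = k and p = p]
    show "integrable lborel (?F I)" by (rule *(1))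
    show "(\<integral>x. cone_form p k w x $ I * u x $ (- I) \<partial>lborel) = (\<integral>t. ?F I t \<partial>lborel)"
      using *(2) by (simp add: cone_form_def)
  qed
  have "(\<integral>x. wedge (cone_form p k w x) (u x) $ UNIV \<partial>lborel) =
      (\<Sum>I\<in>UNIV. wedge_sign I (- I) * (\<integral>t. ?F I t \<partial>lborel))"
    by (simp only: integral_wedge[OF bounded_Borel_cone_form[OF w] u] *(2))
  also have "\<dots> = (\<integral>t. (\<Sum>I\<in>UNIV. wedge_sign I (- I) * ?F I t) \<partial>lborel)"
    by (subst Bochner_Integration.integral_sum[OF integrable_mult_right[OF *(1)]]) (simp only: integral_mult_right_zero)
  also have "(\<lambda>t. \<Sum>I\<in>UNIV. wedge_sign I (- I) * ?F I t) =
     (\<lambda>t. indicator {0<..1} t * (t ^ (k - 1) * (\<integral>x. wedge (w (p + t *\<^sub>R (x - p))) (u x) $ UNIV \<partial>lborel)))"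
    by (simp add: integral_wedge[OF bounded_Borel_dilation[OF w] u] sum_distrib_left mult_ac)
  finally show ?thesis .
qed

text \<open>
  Coefficientwise this is the scalar identity of the previous section: the coefficient of
  \<open>w\<close> at \<open>I\<close>, of degree \<open>k\<close>, is paired with that of
  \<open>\<alpha>\<close> at the complement of \<open>I\<close>, of degree \<open>j = n -
  k\<close>.
\<close>

lemma cone_form_radial_Lie:
  fixes w :: "'n::{finite,linorder} form"
  assumes w: "bounded_Borel_form w" "\<And>y. w y \<in> ext_power k" and k: "k > 0"
    and \<alpha>: "smooth \<alpha>" "bounded {x. \<alpha> x \<noteq> 0}" and n: "j + k = CARD('n)"
  shows "(\<integral>y. wedge (w y) (\<alpha> y) $ UNIV \<partial>lborel) =
    - (\<integral>x. wedge (cone_form p k w x) (radial_Lie p \<alpha> x) $ UNIV \<partial>lborel)"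
proof -
  note L = compact_support_radial_Lie[OF \<alpha>, of p]
  have "(\<integral>y. w y $ I * \<alpha> y $ (- I) \<partial>lborel) = - (\<integral>x. cone_form p k w x $ I * radial_Lie p \<alpha> x $ (- I) \<partial>lborel)" for I
  proof (cases "card I = k")
    case False
    then show ?thesis
      using w(2) cone_form_ext_power[OF w(2)] by (simp add: ext_power_def)
  next
    case True
    let ?f = "\<lambda>x. \<alpha> x $ (- I)"
    have j: "card (- I) = j" using True n by (simp add: Compl_eq_Diff_UNIV card_Diff_subset)
    have d: "?f differentiable (at x)" for x
      using smooth_imp_differentiable[OF \<alpha>(1)] bounded_linear.has_derivative[OF bounded_linear_vec_nth]
      unfolding differentiable_def by blast
    have E: "Euler_op p j ?f = (\<lambda>x. radial_Lie p \<alpha> x $ (- I))"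
      by (simp add: fun_eq_iff Euler_op_def radial_Lie_def j partial_deriv_component[OF smooth_imp_differentiable[OF \<alpha>(1)]])
    obtain S0 where S0: "bounded S0" "\<And>x. x \<notin> S0 \<Longrightarrow> radial_Lie p \<alpha> x = 0"
      using L unfolding compact_support_form_def by blast
    define S where "S = S0 \<union> {x. \<alpha> x \<noteq> 0}"
    have S: "bounded S" "\<And>x. x \<notin> S \<Longrightarrow> ?f x = 0" "\<And>x. x \<notin> S \<Longrightarrow> Euler_op p j ?f x = 0"
      using S0 \<alpha>(2) unfolding E by (auto simp: S_def)
    have c: "continuous_on UNIV (Euler_op p j ?f)"
      using L unfolding E compact_support_form_def by blast
    obtain C where C: "\<And>x. \<bar>w x $ I\<bar> \<le> C" and m: "(\<lambda>x. w x $ I) \<in> borel_measurable borel"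
      using w(1) unfolding bounded_Borel_form_def by blast
    obtain M where M: "\<And>x. \<bar>Euler_op p j ?f x\<bar> \<le> M" using continuous_bounded_support_bound[OF c S(1,3)] by blast
    have "(\<integral>y. w y $ I * \<alpha> y $ (- I) \<partial>lborel) =
        - (\<integral>x. cone_average p k (\<lambda>y. w y $ I) x * Euler_op p j ?f x \<partial>lborel)"
      using dilation_identity_cone[OF m C d c S n k]
        cone_average_Fubini(2)[OF m borel_measurable_continuous_onI[OF c] C M S(1,3)] by simp
    then show ?thesis by (simp add: E cone_form_def)
  qed
  then show ?thesis
    by (simp add: integral_wedge[OF w(1) compact_support_smooth[OF \<alpha>]]
      integral_wedge[OF bounded_Borel_cone_form[OF w(1)] L] sum_negf)
qed

lemma ext_deriv_dilation:
  assumes "\<And>x. \<beta> differentiable (at x)"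
  shows "ext_deriv (\<lambda>y. \<beta> (p + c *\<^sub>R (y - p))) y = c *\<^sub>R ext_deriv \<beta> (p + c *\<^sub>R (y - p))"
  by (simp add: vec_eq_iff ext_deriv_component partial_deriv_dilation(2)[OF assms] sum_distrib_left mult_ac)

text \<open>
  The support of the dilated form is the image of the support of \<open>\<beta>\<close> under the
  dilation by \<open>t\<close>, which maps \<open>V\<close> into itself.
\<close>

lemma test_forms_dilation:
  assumes \<beta>: "\<beta> \<in> test_forms V j" and V: "\<And>x. x \<in> V \<Longrightarrow> p + t *\<^sub>R (x - p) \<in> V" and t: "t > 0"
  shows "(\<lambda>y. \<beta> (p + (1 / t) *\<^sub>R (y - p))) \<in> test_forms V j"
proof -
  let ?\<gamma> = "\<lambda>y. \<beta> (p + (1 / t) *\<^sub>R (y - p))" and ?A = "\<lambda>x. p + t *\<^sub>R (x - p)"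
  let ?K = "closure {x. \<beta> x \<noteq> 0}"
  have c: "compact (?A ` ?K)"
    using \<beta> by (intro compact_continuous_image continuous_intros) (auto simp: test_forms_def)
  have "{y. ?\<gamma> y \<noteq> 0} \<subseteq> ?A ` ?K"
  proof
    fix y assume "y \<in> {y. ?\<gamma> y \<noteq> 0}"
    then have "p + (1 / t) *\<^sub>R (y - p) \<in> ?K" using closure_subset[of "{x. \<beta> x \<noteq> 0}"] by auto
    moreover have "y = ?A (p + (1 / t) *\<^sub>R (y - p))" using t by simp
    ultimately show "y \<in> ?A ` ?K" by blast
  qed
  then have sub: "closure {y. ?\<gamma> y \<noteq> 0} \<subseteq> ?A ` ?K"
    using c by (intro closure_minimal compact_imp_closed)
  moreover have "?A ` ?K \<subseteq> V" using \<beta> V by (auto simp: test_forms_def)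
  moreover have "compact (closure {y. ?\<gamma> y \<noteq> 0})"
    using compact_Int_closed[OF c, of "closure {y. ?\<gamma> y \<noteq> 0}"] sub by (simp add: Int_absorb1)
  moreover have "smooth ?\<gamma>" using \<beta> by (auto simp: test_forms_def smooth_def intro: Ck_dilation)
  ultimately show ?thesis using \<beta> by (auto simp: test_forms_def)
qed

lemma test_forms_radial_contraction:
  assumes \<alpha>: "\<alpha> \<in> test_forms V j"
  shows "radial_contraction p \<alpha> \<in> test_forms V (j - 1)"
proof -
  have "{x. radial_contraction p \<alpha> x \<noteq> 0} \<subseteq> {x. \<alpha> x \<noteq> 0}"
  proof clarify
    fix x assume "radial_contraction p \<alpha> x \<noteq> 0" "\<alpha> x = 0"
    then show False by (simp add: radial_contraction_def interior_prod_def vec_eq_iff)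
  qed
  then have sub: "closure {x. radial_contraction p \<alpha> x \<noteq> 0} \<subseteq> closure {x. \<alpha> x \<noteq> 0}" by (rule closure_mono)
  then have "compact (closure {x. radial_contraction p \<alpha> x \<noteq> 0})"
    using compact_Int_closed[of "closure {x. \<alpha> x \<noteq> 0}" "closure {x. radial_contraction p \<alpha> x \<noteq> 0}"] \<alpha>
    by (simp add: Int_absorb1 test_forms_def)
  moreover have "radial_contraction p \<alpha> x \<in> ext_power (j - 1)" for x
    using \<alpha> unfolding radial_contraction_def by (intro interior_prod_ext_power) (simp add: test_forms_def)
  ultimately show ?thesis
    using \<alpha> sub smooth_radial_contraction by (auto simp: test_forms_def)
qed

text \<open>
  \<open>dw = 0\<close> on \<open>V\<close> in the sense of currents. The integral extends over
  the whole space, where it is unaffected by the values of \<open>w\<close> outside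
  \<open>V\<close> since test forms vanish there.
\<close>

definition closed_on :: "(real ^ 'n::{finite,linorder}) set \<Rightarrow> nat \<Rightarrow> 'n form \<Rightarrow> bool" where
  "closed_on V k w \<longleftrightarrow> (\<forall>j \<gamma>. j + (k + 1) = CARD('n) \<longrightarrow> \<gamma> \<in> test_forms V j \<longrightarrow>
     (\<integral>y. wedge (w y) (ext_deriv \<gamma> y) $ UNIV \<partial>lborel) = 0)"

lemma test_formsD:
  assumes "\<alpha> \<in> test_forms V j"
  shows "smooth \<alpha>" "bounded {x. \<alpha> x \<noteq> 0}"
  using assms bounded_subset[OF compact_imp_bounded closure_subset] by (auto simp: test_forms_def)

text \<open>
  Pull-backs of closed forms are closed. Here the pull-back under the dilation is undone by a
  change of variables, which turns \<open>\<beta>\<close> into a test form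
  \<open>\<gamma>\<close>, dilated towards \<open>p\<close>, and \<open>d\<beta>\<close> into a
  multiple of \<open>d\<gamma>\<close>.
\<close>

lemma dilation_closed:
  fixes w :: "'n::{finite,linorder} form"
  assumes w: "bounded_Borel_form w" and cl: "closed_on V k w"
    and \<beta>: "\<beta> \<in> test_forms V j" and n: "j + (k + 1) = CARD('n)"
    and V: "\<And>x. x \<in> V \<Longrightarrow> p + t *\<^sub>R (x - p) \<in> V" and t: "t > 0"
  shows "(\<integral>x. wedge (w (p + t *\<^sub>R (x - p))) (ext_deriv \<beta> x) $ UNIV \<partial>lborel) = 0"
proof -
  define \<gamma> where "\<gamma> = (\<lambda>y. \<beta> (p + (1 / t) *\<^sub>R (y - p)))"
  have \<gamma>: "\<gamma> \<in> test_forms V j" unfolding \<gamma>_def by (rule test_forms_dilation[OF \<beta> V t])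
  \<comment> \<open>The factor \<open>t\<close> makes up for the chain rule in \<open>d\<gamma>\<close>.\<close>
  define F where "F y = t * wedge (w y) (ext_deriv \<gamma> y) $ UNIV" for y
  have "ext_deriv \<gamma> y = (1 / t) *\<^sub>R ext_deriv \<beta> (p + (1 / t) *\<^sub>R (y - p))" for y
    unfolding \<gamma>_def by (rule ext_deriv_dilation) (rule smooth_imp_differentiable[OF test_formsD(1)[OF \<beta>]])
  then have "ext_deriv \<gamma> (p + t *\<^sub>R (x - p)) = (1 / t) *\<^sub>R ext_deriv \<beta> x" for x
    using t by simp
  then have "wedge (w (p + t *\<^sub>R (x - p))) (ext_deriv \<beta> x) $ UNIV = F (p + t *\<^sub>R (x - p))" for x
    using t by (simp add: F_def wedge_UNIV sum_distrib_left)
  moreover have "F \<in> borel_measurable borel"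
    unfolding F_def using borel_measurable_integrable[OF integrable_wedge[OF w compact_support_ext_deriv[OF test_formsD[OF \<gamma>]]]]
    by simp
  ultimately have "(\<integral>x. wedge (w (p + t *\<^sub>R (x - p))) (ext_deriv \<beta> x) $ UNIV \<partial>lborel) =
      (1 / t) ^ CARD('n) * (\<integral>y. F y \<partial>lborel)"
    using integral_dilation[of F t p] t by simp
  also have "(\<integral>y. F y \<partial>lborel) = 0"
    using cl \<gamma> n unfolding F_def closed_on_def by simp
  finally show ?thesis by simp
qed

lemma cone_form_closed:
  fixes w :: "'n::{finite,linorder} form"
  assumes w: "bounded_Borel_form w" and cl: "closed_on V k w"
    and \<beta>: "\<beta> \<in> test_forms V j" and n: "j + (k + 1) = CARD('n)"
    and V: "\<And>x t. x \<in> V \<Longrightarrow> 0 < t \<Longrightarrow> t \<le> 1 \<Longrightarrow> p + t *\<^sub>R (x - p) \<in> V"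
  shows "(\<integral>x. wedge (cone_form p k w x) (ext_deriv \<beta> x) $ UNIV \<partial>lborel) = 0"
proof -
  have "indicator {0<..1} t * (t ^ (k - 1) * (\<integral>x. wedge (w (p + t *\<^sub>R (x - p))) (ext_deriv \<beta> x) $ UNIV \<partial>lborel)) = 0" for t
    using dilation_closed[OF w cl \<beta> n V, of t] by (auto split: split_indicator)
  then show ?thesis
    by (simp only: cone_form_Fubini[OF w compact_support_ext_deriv[OF test_formsD[OF \<beta>]]] integral_zero)
qed

lemma interior_prod_zero_form:
  assumes "v \<in> ext_power 0"
  shows "interior_prod X v = 0"
  using assms by (auto simp: ext_power_def interior_prod_def vec_eq_iff card_insert_if intro!: sum.neutral)

text \<open>
  This is \<open>d\<theta> = w\<close>, up to the sign in the differential of a current, for the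
  form \<open>\<theta>\<close> that the cone operator assigns to \<open>w\<close>. The contraction
  moves to \<open>d\<alpha>\<close>, Cartan's formula replaces it by the Lie derivative of
  \<open>\<alpha>\<close> minus an exact form, and closedness removes the latter.
\<close>

lemma cone_primitive:
  fixes w :: "'n::{finite,linorder} form"
  assumes w: "bounded_Borel_form w" "\<And>y. w y \<in> ext_power k" and k: "k > 0" and cl: "closed_on V k w"
    and V: "\<And>x t. x \<in> V \<Longrightarrow> 0 < t \<Longrightarrow> t \<le> 1 \<Longrightarrow> p + t *\<^sub>R (x - p) \<in> V"
    and \<alpha>: "\<alpha> \<in> test_forms V j" and n: "j + k = CARD('n)"
  shows "(\<integral>x. wedge (interior_prod (x - p) (cone_form p k w x)) (ext_deriv \<alpha> x) $ UNIV \<partial>lborel) =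
    (- 1) ^ k * (\<integral>y. wedge (w y) (\<alpha> y) $ UNIV \<partial>lborel)"
proof -
  let ?W = "cone_form p k w" and ?\<beta> = "radial_contraction p \<alpha>"
  note W = bounded_Borel_cone_form[OF w(1), of p k]
  note \<alpha>' = test_formsD[OF \<alpha>]
  have \<beta>: "?\<beta> \<in> test_forms V (j - 1)" by (rule test_forms_radial_contraction[OF \<alpha>])
  have zero: "(\<integral>x. wedge (?W x) (ext_deriv ?\<beta> x) $ UNIV \<partial>lborel) = 0"
  proof (cases "j = 0")
    case True
    \<comment> \<open>There are no forms of degree \<open>j - 1\<close> to contract to: the contraction of a function is zero.\<close>
    then have "?\<beta> = (\<lambda>_. 0)"
      using \<alpha> interior_prod_zero_form by (auto simp: test_forms_def radial_contraction_def fun_eq_iff)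
    then show ?thesis by (simp add: wedge_UNIV ext_deriv_component partial_deriv_const)
  next
    case False
    then show ?thesis using n by (intro cone_form_closed[OF w(1) cl \<beta> _ V]) auto
  qed
  have split: "wedge (?W x) (interior_prod (x - p) (ext_deriv \<alpha> x)) $ UNIV =
      wedge (?W x) (radial_Lie p \<alpha> x) $ UNIV - wedge (?W x) (ext_deriv ?\<beta> x) $ UNIV" for x
  proof -
    have "interior_prod (x - p) (ext_deriv \<alpha> x) = radial_Lie p \<alpha> x - ext_deriv ?\<beta> x"
      using Cartan_formula[OF smooth_imp_differentiable[OF \<alpha>'(1)], of x p] by (simp add: eq_diff_eq)
    then show ?thesis by (simp add: wedge_UNIV right_diff_distrib sum_subtractf)
  qed
  have "(\<integral>x. wedge (interior_prod (x - p) (?W x)) (ext_deriv \<alpha> x) $ UNIV \<partial>lborel) =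
      (\<integral>x. (- 1) ^ (k + 1) * wedge (?W x) (interior_prod (x - p) (ext_deriv \<alpha> x)) $ UNIV \<partial>lborel)"
    by (simp only: wedge_interior_prod_UNIV[OF cone_form_ext_power[OF w(2)]])
  also have "\<dots> = (- 1) ^ (k + 1) * (\<integral>x. wedge (?W x) (radial_Lie p \<alpha> x) $ UNIV - wedge (?W x) (ext_deriv ?\<beta> x) $ UNIV \<partial>lborel)"
    by (simp only: split integral_mult_right_zero)
  also have "\<dots> = (- 1) ^ (k + 1) * (\<integral>x. wedge (?W x) (radial_Lie p \<alpha> x) $ UNIV \<partial>lborel)"
    by (subst Bochner_Integration.integral_diff[OF integrable_wedge[OF W compact_support_radial_Lie[OF \<alpha>']]
        integrable_wedge[OF W compact_support_ext_deriv[OF test_formsD[OF \<beta>]]]]) (simp only: zero diff_0_right)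
  also have "\<dots> = (- 1) ^ k * (\<integral>y. wedge (w y) (\<alpha> y) $ UNIV \<partial>lborel)"
    by (subst cone_form_radial_Lie[OF w k \<alpha>' n, of p]) simp
  finally show ?thesis .
qed

section \<open>Weakly closed functions\<close>

text \<open>
  The functions \<open>s\<^bsup>-m\<^esup> exp (-1/s)\<close>, extended by zero. Their derivatives
  are linear combinations of functions of the same kind, so that all of them are smooth by a
  single induction; the case \<open>m = 0\<close> is the usual building block of bump functions.
\<close>

definition flat_exp :: "nat \<Rightarrow> real \<Rightarrow> real" where
  "flat_exp m s = (if s > 0 then (1 / s) ^ m * exp (- (1 / s)) else 0)"

lemma flat_exp_tendsto_0: "(flat_exp m \<longlongrightarrow> 0) (at 0)"
proof -
  have "((\<lambda>s::real. (1 / s) ^ m / exp (1 / s)) \<longlongrightarrow> 0) (at_right 0)"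
    by (rule filterlim_compose[OF tendsto_power_div_exp_0])
       (simp add: divide_inverse filterlim_inverse_at_top_right)
  moreover have "\<forall>\<^sub>F s in at_right 0. (1 / s) ^ m / exp (1 / s) = flat_exp m s"
    by (auto simp: flat_exp_def exp_minus field_simps eventually_at_filter)
  ultimately have "(flat_exp m \<longlongrightarrow> 0) (at_right 0)"
    using tendsto_cong by fast
  moreover have "\<forall>\<^sub>F s in at_left 0. flat_exp m s = 0"
    by (auto simp: flat_exp_def eventually_at_filter)
  then have "(flat_exp m \<longlongrightarrow> 0) (at_left 0)"
    by (rule tendsto_eventually)
  ultimately show ?thesis by (simp add: filterlim_split_at)
qed

lemma flat_exp_derivative:
  "(flat_exp m has_real_derivative - real m * flat_exp (m + 1) s + flat_exp (m + 2) s) (at s)"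
proof -
  consider "s > 0" | "s < 0" | "s = 0" by linarith
  then show ?thesis
  proof cases
    case 1
    have inv: "((\<lambda>s. 1 / s) has_real_derivative - ((1 / s) * (1 / s))) (at s)"
      using 1 by (auto intro!: derivative_eq_intros)
    have pow: "((\<lambda>s. (1 / s) ^ m) has_real_derivative - (real m * (1 / s) ^ (m + 1))) (at s)"
      using DERIV_power[OF inv, of m] by (cases m) (simp_all add: mult_ac)
    have ex: "((\<lambda>s. exp (- (1 / s))) has_real_derivative exp (- (1 / s)) * ((1 / s) * (1 / s))) (at s)"
      using DERIV_fun_exp[OF DERIV_minus[OF inv]] by simp
    have "((\<lambda>s. (1 / s) ^ m * exp (- (1 / s))) has_real_derivative
        - real m * flat_exp (m + 1) s + flat_exp (m + 2) s) (at s)"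
      using DERIV_mult[OF pow ex] 1 by (simp add: flat_exp_def mult_ac)
    moreover have "open {0::real<..}" by simp
    ultimately show ?thesis
      by (rule has_field_derivative_transform_within_open) (use 1 in \<open>auto simp: flat_exp_def\<close>)
  next
    case 2
    have "((\<lambda>_. 0) has_real_derivative 0) (at s)" by simp
    then have "(flat_exp m has_real_derivative 0) (at s)"
      by (rule has_field_derivative_transform_within_open[of _ _ _ "{..<0}"]) (use 2 in \<open>auto simp: flat_exp_def\<close>)
    then show ?thesis using 2 by (simp add: flat_exp_def)
  next
    case 3
    \<comment> \<open>The difference quotient at \<open>0\<close> belongs to the same family.\<close>
    have "flat_exp m h / h = flat_exp (m + 1) h" for h by (auto simp: flat_exp_def)
    moreover have "flat_exp l 0 = 0" for l by (simp add: flat_exp_def)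
    ultimately show ?thesis
      using flat_exp_tendsto_0[of "m + 1"] 3 by (simp add: has_field_derivative_iff)
  qed
qed

lemma Ck_flat_exp: "Ck N (\<lambda>x::real ^ 'n::finite. flat_exp m (c * x $ i + d))"
proof (induction N arbitrary: m)
  case 0
  have "continuous_on UNIV (flat_exp m)"
    by (metis flat_exp_derivative DERIV_isCont continuous_at_imp_continuous_on)
  then show ?case by (auto intro!: continuous_on_compose2[of UNIV "flat_exp m"] continuous_intros)
next
  case (Suc N)
  let ?s = "\<lambda>x::real ^ 'n. c * x $ i + d"
  let ?F' = "\<lambda>x. - real m * flat_exp (m + 1) (?s x) + flat_exp (m + 2) (?s x)"
  have "(?s has_derivative (\<lambda>v. c * v $ i)) (at x)" for x
    by (auto intro!: derivative_eq_intros bounded_linear.has_derivative[OF bounded_linear_vec_nth])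
  from has_derivative_compose[OF this flat_exp_derivative[unfolded has_field_derivative_def]]
  have D: "((\<lambda>x. flat_exp m (?s x)) has_derivative (\<lambda>v. ?F' x * (c * v $ i))) (at x)" for x .
  have "partial_deriv l (\<lambda>x. flat_exp m (?s x)) = (\<lambda>x. (if l = i then c else 0) * ?F' x)" for l
    using partial_deriv_eq[OF D, of l] by (auto simp: axis_def fun_eq_iff)
  moreover have "Ck N (\<lambda>x. (if l = i then c else 0) * ?F' x)" for l
    by (intro Ck_mult Ck_add Ck_const Suc.IH)
  ultimately show ?case using D by (auto simp: differentiable_def)
qed

text \<open>
  Since \<open>exp (-1 / (N s))\<close> tends to \<open>1\<close> for every \<open>s > 0\<close>,
  these bump functions converge to the indicator function of the open box and all vanish outside
  it.
\<close>

definition box_bump :: "real ^ 'n \<Rightarrow> real ^ 'n \<Rightarrow> nat \<Rightarrow> real ^ 'n::finite \<Rightarrow> real" where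
  "box_bump a b N x = (\<Prod>i\<in>UNIV. flat_exp 0 (real (Suc N) * (x $ i - a $ i)) * flat_exp 0 (real (Suc N) * (b $ i - x $ i)))"

lemma smooth_box_bump:
  fixes a b :: "real ^ 'n::finite"
  shows "smooth (box_bump a b N)"
proof -
  have "Ck m (\<lambda>x::real ^ 'n. flat_exp 0 (real (Suc N) * (x $ i - a $ i)))"
    "Ck m (\<lambda>x::real ^ 'n. flat_exp 0 (real (Suc N) * (b $ i - x $ i)))" for m i
  proof -
    have "Ck m (\<lambda>x::real ^ 'n. flat_exp 0 (c * (x $ i - d)))" for c d
      using Ck_flat_exp[of m 0 c i "- c * d"] by (simp add: right_diff_distrib)
    moreover have "Ck m (\<lambda>x::real ^ 'n. flat_exp 0 (c * (d - x $ i)))" for c d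
      using Ck_flat_exp[of m 0 "- c" i "c * d"] by (simp add: right_diff_distrib)
    ultimately show "Ck m (\<lambda>x::real ^ 'n. flat_exp 0 (real (Suc N) * (x $ i - a $ i)))"
      "Ck m (\<lambda>x::real ^ 'n. flat_exp 0 (real (Suc N) * (b $ i - x $ i)))"
      by blast+
  qed
  then show ?thesis
    unfolding smooth_def box_bump_def[abs_def] by (intro allI Ck_prod Ck_mult)
qed

lemma box_bump_nonneg: "0 \<le> box_bump a b N x"
  unfolding box_bump_def by (intro prod_nonneg mult_nonneg_nonneg) (auto simp: flat_exp_def)

lemma box_bump_le: "box_bump a b N x \<le> indicator (box a b) x"
proof (cases "x \<in> box a b")
  case True
  have "0 \<le> flat_exp 0 s" "flat_exp 0 s \<le> 1" for s by (auto simp: flat_exp_def)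
  then show ?thesis
    unfolding box_bump_def using True by (auto intro!: prod_le_1 mult_le_one)
next
  case False
  then obtain i where "\<not> a $ i < x $ i \<or> \<not> x $ i < b $ i" by (auto simp: mem_box_cart)
  then have "flat_exp 0 (real (Suc N) * (x $ i - a $ i)) * flat_exp 0 (real (Suc N) * (b $ i - x $ i)) = 0"
    by (auto simp: flat_exp_def zero_less_mult_iff)
  then have "box_bump a b N x = 0" unfolding box_bump_def by (intro prod_zero) auto
  then show ?thesis by simp
qed

lemma box_bump_eq_0: "x \<notin> box a b \<Longrightarrow> box_bump a b N x = 0"
  using box_bump_le[of a b N x] box_bump_nonneg[of a b N x] by simp

lemma box_bump_tendsto: "(\<lambda>N. box_bump a b N x) \<longlonglongrightarrow> indicator (box a b) x"
proof (cases "x \<in> box a b")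
  case True
  have lim: "(\<lambda>N. flat_exp 0 (real (Suc N) * s)) \<longlonglongrightarrow> 1" if s: "s > 0" for s
  proof -
    have "(\<lambda>N. (1 / real (Suc N)) * (1 / s)) \<longlonglongrightarrow> 0 * (1 / s)"
      by (intro tendsto_mult tendsto_const LIMSEQ_Suc[OF lim_1_over_n])
    then have "(\<lambda>N. exp (- ((1 / real (Suc N)) * (1 / s)))) \<longlonglongrightarrow> exp (- (0 * (1 / s)))"
      by (intro tendsto_exp tendsto_minus)
    then show ?thesis using s by (simp add: flat_exp_def)
  qed
  have "(\<lambda>N. box_bump a b N x) \<longlonglongrightarrow> (\<Prod>i\<in>(UNIV :: 'a set). 1 * 1)"
    unfolding box_bump_def using True
    by (intro tendsto_prod tendsto_mult lim) (auto simp: mem_box_cart)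
  then show ?thesis using True by simp
qed (simp add: box_bump_eq_0)

text \<open>
  View \<open>\<phi>\<close> as a form \<open>\<alpha>\<close> of top degree. Then
  \<open>d\<alpha> = 0\<close>, so by Cartan's formula the Lie derivative of
  \<open>\<alpha>\<close> is exact and pairs to zero with every dilate of \<open>w\<close>. Hence
  the right-hand side of the dilation identity for \<open>k = 0\<close> vanishes.
\<close>

lemma dilation_closed_zero_form:
  fixes w :: "'n::{finite,linorder} form"
  assumes w: "bounded_Borel_form w" "\<And>y. w y \<in> ext_power 0" and cl: "closed_on V 0 w"
    and V: "\<And>x t. x \<in> V \<Longrightarrow> 0 < t \<Longrightarrow> t \<le> 1 \<Longrightarrow> p + t *\<^sub>R (x - p) \<in> V"
    and \<phi>: "smooth \<phi>" "compact K" "K \<subseteq> V" "\<And>x. x \<notin> K \<Longrightarrow> \<phi> x = 0"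
    and e: "0 < e" "e \<le> 1"
  shows "(\<integral>x. w (p + e *\<^sub>R (x - p)) $ {} * \<phi> x \<partial>lborel) = (\<integral>y. w y $ {} * \<phi> y \<partial>lborel)"
proof -
  define \<alpha> :: "'n form" where "\<alpha> x = \<phi> x *\<^sub>R axis UNIV 1" for x
  have \<alpha>U: "\<alpha> x $ UNIV = \<phi> x" for x by (simp add: \<alpha>_def)
  have supp: "closure {x. \<alpha> x \<noteq> 0} \<subseteq> K"
    using \<phi> by (intro closure_minimal) (auto simp: \<alpha>_def compact_imp_closed)
  have "smooth \<alpha>"
    using \<phi>(1) Ck_linear[OF bounded_linear_scaleR_left] unfolding smooth_def \<alpha>_def[abs_def] by blast
  moreover have "compact (closure {x. \<alpha> x \<noteq> 0})"
    using compact_Int_closed[OF \<phi>(2), of "closure {x. \<alpha> x \<noteq> 0}"] supp by (simp add: Int_absorb1)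
  moreover have "\<alpha> x \<in> ext_power CARD('n)" for x
    by (auto simp: \<alpha>_def ext_power_def axis_def)
  ultimately have \<alpha>: "\<alpha> \<in> test_forms V CARD('n)"
    using supp \<phi>(3) by (auto simp: test_forms_def)
  let ?\<beta> = "radial_contraction p \<alpha>"
  have \<beta>: "?\<beta> \<in> test_forms V (CARD('n) - 1)" by (rule test_forms_radial_contraction[OF \<alpha>])
  have top: "wedge v u $ UNIV = v $ {} * u $ UNIV" if "v \<in> ext_power 0" for v u :: "'n extalg"
  proof -
    have "wedge v u $ UNIV = (\<Sum>I\<in>(UNIV :: 'n set set). if I = {} then v $ {} * u $ UNIV else 0)"
      unfolding wedge_UNIV
      by (intro sum.cong refl) (use that in \<open>auto simp: ext_power_def wedge_sign_def\<close>)
    then show ?thesis by (simp add: sum.delta)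
  qed
  have E: "Euler_op p CARD('n) \<phi> x = ext_deriv ?\<beta> x $ UNIV" for x
  proof -
    have d: "\<alpha> differentiable (at x)" by (rule smooth_imp_differentiable[OF \<open>smooth \<alpha>\<close>])
    have "partial_deriv i \<alpha> x $ UNIV = partial_deriv i \<phi> x" for i
      using partial_deriv_component[OF d, of i UNIV] by (simp add: \<alpha>U)
    then have "Euler_op p CARD('n) \<phi> x = radial_Lie p \<alpha> x $ UNIV"
      by (simp add: Euler_op_def radial_Lie_def \<alpha>U)
    also have "\<dots> = ext_deriv ?\<beta> x $ UNIV"
      unfolding Cartan_formula[OF d, of p, symmetric] by (simp add: interior_prod_def)
    finally show ?thesis .
  qed
  have zero: "(\<integral>x. w (p + t *\<^sub>R (x - p)) $ {} * Euler_op p CARD('n) \<phi> x \<partial>lborel) = 0"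
    if "0 < t" "t \<le> 1" for t
    using dilation_closed[OF w(1) cl \<beta> _ V that(1)] that by (simp add: E top w(2))
  note u = compact_support_ext_deriv[OF test_formsD[OF \<beta>]]
  obtain S0 where S0: "bounded S0" "\<And>x. x \<notin> S0 \<Longrightarrow> ext_deriv ?\<beta> x = 0"
    using u unfolding compact_support_form_def by blast
  obtain C where C: "\<And>x. \<bar>w x $ {}\<bar> \<le> C" and m: "(\<lambda>x. w x $ {}) \<in> borel_measurable borel"
    using w(1) unfolding bounded_Borel_form_def by blast
  have c: "continuous_on UNIV (Euler_op p CARD('n) \<phi>)"
    using u unfolding compact_support_form_def E by blast
  have "(\<integral>y. w y $ {} * \<phi> y \<partial>lborel) - e ^ 0 * (\<integral>x. w (p + e *\<^sub>R (x - p)) $ {} * \<phi> x \<partial>lborel) =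
    - (\<integral>t. indicator {e..1} t * (t ^ 0 / t * (\<integral>x. w (p + t *\<^sub>R (x - p)) $ {} * Euler_op p CARD('n) \<phi> x \<partial>lborel)) \<partial>lborel)"
  proof (rule dilation_identity[OF m C smooth_imp_differentiable[OF \<phi>(1)] c _ _ _ _ e])
    show "bounded (S0 \<union> K)" using S0 \<phi>(2) compact_imp_bounded by auto
  qed (use S0 \<phi> E in auto)
  also have "\<dots> = 0"
  proof -
    have "indicator {e..1} t * (t ^ 0 / t * (\<integral>x. w (p + t *\<^sub>R (x - p)) $ {} * Euler_op p CARD('n) \<phi> x \<partial>lborel)) = 0" for t
      using zero[of t] e by (auto split: split_indicator)
    then show ?thesis by (simp only: integral_zero)
  qed
  finally show ?thesis by simp
qed

lemma box_average_dilation: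
  fixes w :: "'n::{finite,linorder} form"
  assumes w: "bounded_Borel_form w" "\<And>y. w y \<in> ext_power 0" and cl: "closed_on V 0 w"
    and V: "\<And>x t. x \<in> V \<Longrightarrow> 0 < t \<Longrightarrow> t \<le> 1 \<Longrightarrow> p + t *\<^sub>R (x - p) \<in> V"
    and ab: "cbox a b \<subseteq> V" and e: "0 < e" "e \<le> 1"
  shows "(\<integral>x. w (p + e *\<^sub>R (x - p)) $ {} * indicator (box a b) x \<partial>lborel) = (\<integral>y. w y $ {} * indicator (box a b) y \<partial>lborel)"
proof -
  have lim: "(\<lambda>N. \<integral>x. v x $ {} * box_bump a b N x \<partial>lborel) \<longlonglongrightarrow> (\<integral>x. v x $ {} * indicator (box a b) x \<partial>lborel)"
    if v: "bounded_Borel_form v" for v :: "'n form"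
  proof -
    obtain C where C: "\<And>x. \<bar>v x $ {}\<bar> \<le> C" and m[measurable]: "(\<lambda>x. v x $ {}) \<in> borel_measurable borel"
      using v unfolding bounded_Borel_form_def by blast
    have C0: "0 \<le> C" using C[of 0] by linarith
    have [measurable]: "box_bump a b N \<in> borel_measurable borel" for N
      by (intro borel_measurable_continuous_onI smooth_imp_continuous smooth_box_bump)
    show ?thesis
    proof (rule integral_dominated_convergence[where w = "\<lambda>x. C * indicator (box a b) x"])
      show "integrable lborel (\<lambda>x. C * indicator (box a b) x)"
        by (intro integrable_mult_right integrable_real_indicator) (auto simp: emeasure_lborel_box_eq)
      show "AE x in lborel. (\<lambda>N. v x $ {} * box_bump a b N x) \<longlonglongrightarrow> v x $ {} * indicator (box a b) x"
        by (intro AE_I2 tendsto_mult tendsto_const box_bump_tendsto)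
      show "AE x in lborel. norm (v x $ {} * box_bump a b N x) \<le> C * indicator (box a b) x" for N
      proof (rule AE_I2)
        fix x
        have "\<bar>v x $ {}\<bar> * \<bar>box_bump a b N x\<bar> \<le> C * indicator (box a b) x"
          using box_bump_le[of a b N x] box_bump_nonneg[of a b N x] C0 by (intro mult_mono C) auto
        then show "norm (v x $ {} * box_bump a b N x) \<le> C * indicator (box a b) x"
          by (simp add: abs_mult)
      qed
    qed measurable
  qed
  have "(\<integral>x. w (p + e *\<^sub>R (x - p)) $ {} * box_bump a b N x \<partial>lborel) = (\<integral>y. w y $ {} * box_bump a b N y \<partial>lborel)" for N
    by (rule dilation_closed_zero_form[OF w cl V smooth_box_bump _ ab _ e])
       (auto intro: box_bump_eq_0 dest: subsetD[OF box_subset_cbox])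
  then show ?thesis
    using LIMSEQ_unique[OF lim[OF bounded_Borel_dilation[OF w(1)]]] lim[OF w(1)] by simp
qed

lemma One_eq_vec: "(One :: real ^ 'n::finite) = vec 1"
proof -
  have "(One :: real ^ 'n) \<bullet> axis i 1 = 1" for i
    by (rule inner_sum_Basis) simp
  then have "(One :: real ^ 'n) $ i = 1" for i
    by (subst cart_eq_inner_axis)
  then show ?thesis by (simp only: vec_eq_iff vec_component) simp
qed

text \<open>
  Each cube whose closure lies in the interior of a given one is the image of the latter under a
  dilation about a point inside, the fixed point of the affine map from the larger cube to the
  smaller one. The integrals over the two cubes are therefore related by the invariance under
  dilations.
\<close>

lemma cube_average_eq:
  fixes w :: "'n::{finite,linorder} form"
  assumes w: "bounded_Borel_form w" "\<And>y. w y \<in> ext_power 0" and cl: "closed_on V 0 w"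
    and V: "convex V" "cbox a (a + s *\<^sub>R One) \<subseteq> V"
    and s: "0 < h" "h < s" and y: "\<And>i. a $ i < y $ i" "\<And>i. y $ i + h < a $ i + s"
  shows "(\<integral>x. w x $ {} * indicator (box y (y + h *\<^sub>R One)) x \<partial>lborel) / h ^ CARD('n) =
    (\<integral>x. w x $ {} * indicator (box a (a + s *\<^sub>R One)) x \<partial>lborel) / s ^ CARD('n)"
proof -
  define e where "e = h / s"
  have e: "0 < e" "e < 1" "e * s = h" using s by (auto simp: e_def)
  \<comment> \<open>The centre of the dilation by \<open>e\<close> that maps the corner \<open>a\<close> to the corner \<open>y\<close>.\<close>
  define p where "p = (1 / (1 - e)) *\<^sub>R (y - e *\<^sub>R a)"
  have "(1 - e) *\<^sub>R p = y - e *\<^sub>R a" unfolding p_def using e by simp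
  then have yp: "y = p + e *\<^sub>R (a - p)" by (simp add: algebra_simps)
  have pa: "(1 - e) * (p $ i - a $ i) = y $ i - a $ i" for i
    unfolding yp by (simp add: algebra_simps)
  have "p \<in> cbox a (a + s *\<^sub>R One)"
    unfolding mem_box_cart
  proof (intro allI conjI)
    fix i
    have "0 \<le> (1 - e) * (p $ i - a $ i)" using y(1)[of i] by (simp add: pa)
    then show "a $ i \<le> p $ i" using e by (simp add: zero_le_mult_iff)
    have "(1 - e) * s = s - h" using e(3) by (simp add: left_diff_distrib)
    then have "(1 - e) * (p $ i - a $ i) \<le> (1 - e) * s"
      using y(2)[of i] unfolding pa by simp
    then show "p $ i \<le> (a + s *\<^sub>R One) $ i" using e by (simp add: One_eq_vec)
  qed
  then have p: "p \<in> V" using V by blast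
  have star: "p + t *\<^sub>R (x - p) \<in> V" if "x \<in> V" "0 < t" "t \<le> 1" for x t
    using convexD_alt[OF V(1) p that(1), of t] that by (simp add: algebra_simps)
  obtain C where C: "\<And>x. \<bar>w x $ {}\<bar> \<le> C" and m[measurable]: "(\<lambda>x. w x $ {}) \<in> borel_measurable borel"
    using w(1) unfolding bounded_Borel_form_def by blast
  define F where "F x = w x $ {} * indicator (box y (y + h *\<^sub>R One)) x" for x
  have [measurable]: "F \<in> borel_measurable borel" unfolding F_def by measurable
  have "x \<in> box a (a + s *\<^sub>R One) \<longleftrightarrow> p + e *\<^sub>R (x - p) \<in> box y (y + h *\<^sub>R One)" for x
  proof -
    have "(p + e *\<^sub>R (x - p)) $ i = y $ i + e * (x $ i - a $ i)" for i
      unfolding yp by (simp add: algebra_simps)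
    moreover have "e * (x $ i - a $ i) < h \<longleftrightarrow> x $ i - a $ i < s" for i
      using e by (simp flip: e(3))
    moreover have "0 < e * (x $ i - a $ i) \<longleftrightarrow> 0 < x $ i - a $ i" for i
      using e by (simp add: zero_less_mult_iff)
    moreover have "(a + s *\<^sub>R One) $ i = a $ i + s" "(y + h *\<^sub>R One) $ i = y $ i + h" for i
      by (simp_all add: One_eq_vec)
    ultimately show ?thesis unfolding mem_box_cart by (smt (verit))
  qed
  then have "(\<integral>x. w (p + e *\<^sub>R (x - p)) $ {} * indicator (box a (a + s *\<^sub>R One)) x \<partial>lborel) = (\<integral>x. F (p + e *\<^sub>R (x - p)) \<partial>lborel)"
    unfolding F_def by (intro Bochner_Integration.integral_cong refl) (simp add: indicator_def)
  also have "\<dots> = (1 / e) ^ CARD('n) * (\<integral>x. F x \<partial>lborel)"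
    using integral_dilation[of F e p] e by simp
  finally have "(\<integral>x. w x $ {} * indicator (box a (a + s *\<^sub>R One)) x \<partial>lborel) = (1 / e) ^ CARD('n) * (\<integral>x. F x \<partial>lborel)"
    using box_average_dilation[OF w cl star V(2), of e] e by simp
  then show ?thesis
    using s unfolding F_def e_def by (simp add: power_divide)
qed

lemma integral_cube_eq:
  fixes g :: "'a::euclidean_space \<Rightarrow> real"
  assumes [measurable]: "g \<in> borel_measurable borel" and C: "\<And>x. \<bar>g x\<bar> \<le> C"
  shows "integral (cbox a b) g = (\<integral>x. g x * indicator (box a b) x \<partial>lborel)"
    "g integrable_on cbox a b"
proof -
  have "integrable lborel (\<lambda>x. g x * indicator A x)" if "A \<in> {box a b, cbox a b}" for A
    using that C by (intro integrable_bounded_mult[where C = C] integrable_real_indicator)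
      (auto simp: emeasure_lborel_box_eq emeasure_lborel_cbox_eq)
  then have "set_integrable lborel A g" if "A \<in> {box a b, cbox a b}" for A
    using that unfolding set_integrable_def by (simp add: mult.commute)
  note * = set_borel_integral_eq_integral[OF this]
  show "integral (cbox a b) g = (\<integral>x. g x * indicator (box a b) x \<partial>lborel)"
    using *(2)[of "box a b"] by (simp add: integral_open_interval set_lebesgue_integral_def mult.commute)
  show "g integrable_on cbox a b" using *(1) by simp
qed

text \<open>
  At a point of differentiability the value of \<open>w\<close> is the limit of averages over
  small cubes, which all equal the average over any concentric subcube of \<open>V\<close> that
  contains the point. Two such points lie in a common subcube, so their values agree.
\<close>

lemma closed_zero_form_constant:
  fixes p :: "real ^ 'n::{finite,linorder}" and w :: "'n form"
  defines "V \<equiv> box (p - One) (p + One)"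
  assumes w: "bounded_Borel_form w" "\<And>y. w y \<in> ext_power 0" and cl: "closed_on V 0 w"
  shows "\<exists>c. AE y in lebesgue. y \<in> V \<longrightarrow> w y = c"
proof -
  define g where "g x = w x $ {}" for x
  obtain C where C: "\<And>x. \<bar>g x\<bar> \<le> C" and m: "g \<in> borel_measurable borel"
    using w(1) unfolding bounded_Borel_form_def g_def by blast
  obtain N where N: "negligible N" and lim: "\<And>x e. x \<notin> N \<Longrightarrow> 0 < e \<Longrightarrow>
      \<exists>d>0. \<forall>h. 0 < h \<and> h < d \<longrightarrow> norm (integral (cbox x (x + h *\<^sub>R One)) g /\<^sub>R h ^ DIM((real, 'n) vec) - g x) < e"
    using integrable_ccontinuous_explicit[OF integral_cube_eq(2)[OF m C]] by metis
  define avg where "avg y h = integral (cbox y (y + h *\<^sub>R One)) g / h ^ CARD('n)" for y :: "(real, 'n) vec" and h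
  have value_eq: "g y = avg (p - r *\<^sub>R One) (2 * r)"
    if y: "y \<notin> N" and r: "0 < r" "r < 1" "\<And>i. \<bar>y $ i - p $ i\<bar> < r" for y r
  proof (rule ccontr)
    let ?a = "p - r *\<^sub>R One"
    assume "g y \<noteq> avg ?a (2 * r)"
    then obtain d where d: "d > 0" "\<And>h. 0 < h \<Longrightarrow> h < d \<Longrightarrow> \<bar>avg y h - g y\<bar> < \<bar>avg ?a (2 * r) - g y\<bar>"
      using lim[OF y, of "\<bar>avg ?a (2 * r) - g y\<bar>"] by (auto simp: avg_def divide_inverse_commute)
    \<comment> \<open>\<open>d'\<close> is the distance from \<open>y\<close> to the upper faces of the larger cube; for \<open>h < d'\<close> the small cube fits in.\<close>
    define d' where "d' = Min (range (\<lambda>i. p $ i + r - y $ i))"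
    have "d' > 0" unfolding d'_def using r by (subst Min_gr_iff) (auto simp: abs_less_iff algebra_simps)
    define h where "h = min (min d d') r / 2"
    have h: "0 < h" "h < d" "h < d'" "h < 2 * r" using d(1) \<open>d' > 0\<close> r by (auto simp: h_def)
    have "d' \<le> p $ i + r - y $ i" for i unfolding d'_def by (intro Min_le) auto
    then have "y $ i + h < ?a $ i + 2 * r" for i using h(3) by (simp add: One_eq_vec algebra_simps) (smt (verit))
    moreover have "?a $ i < y $ i" for i using r(3)[of i] by (simp add: One_eq_vec abs_less_iff)
    moreover have "cbox ?a (?a + (2 * r) *\<^sub>R One) \<subseteq> V"
      unfolding V_def using r by (auto simp: mem_box_cart One_eq_vec subset_iff) (smt (verit))+
    ultimately have "avg y h = avg ?a (2 * r)"
      using cube_average_eq[OF w cl _ _ h(1,4), of ?a y]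
      unfolding avg_def integral_cube_eq(1)[OF m C] g_def by (simp add: V_def convex_box)
    then show False using d(2)[OF h(1,2)] by simp
  qed
  have const: "g y = g z" if yz: "y \<in> V" "z \<in> V" "y \<notin> N" "z \<notin> N" for y z
  proof -
    define M where "M = Max (range (\<lambda>i. max \<bar>y $ i - p $ i\<bar> \<bar>z $ i - p $ i\<bar>))"
    have "max \<bar>y $ i - p $ i\<bar> \<bar>z $ i - p $ i\<bar> < 1" for i
      using yz(1,2) by (auto simp: V_def mem_box_cart One_eq_vec abs_less_iff algebra_simps)
    then have "M < 1" unfolding M_def by (subst Max_less_iff) auto
    have M: "max \<bar>y $ i - p $ i\<bar> \<bar>z $ i - p $ i\<bar> \<le> M" for i unfolding M_def by (intro Max_ge) auto
    have "0 \<le> M" using M[of undefined] by (auto simp: le_max_iff_disj intro: order_trans[OF abs_ge_zero])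
    define r where "r = (1 + M) / 2"
    have r: "0 < r" "r < 1" "M < r" using \<open>M < 1\<close> \<open>0 \<le> M\<close> by (auto simp: r_def)
    have "\<bar>y $ i - p $ i\<bar> < r" "\<bar>z $ i - p $ i\<bar> < r" for i using M[of i] r(3) by auto
    then show ?thesis using value_eq[OF yz(3) r(1,2)] value_eq[OF yz(4) r(1,2)] by simp
  qed
  have "\<exists>c. \<forall>y\<in>V - N. w y = c"
  proof (cases "V \<subseteq> N")
    case False
    then obtain z where z: "z \<in> V" "z \<notin> N" by blast
    have "w y = w z" if "y \<in> V - N" for y
    proof -
      have "w y $ I = w z $ I" for I
      proof (cases "I = {}")
        case True
        then show ?thesis using const[of y z] that z by (simp add: g_def)
      next
        case False
        then show ?thesis using w(2) by (simp add: ext_power_def)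
      qed
      then show ?thesis by (simp add: vec_eq_iff)
    qed
    then show ?thesis by blast
  qed auto
  then obtain c where c: "\<And>y. y \<in> V \<Longrightarrow> y \<notin> N \<Longrightarrow> w y = c" by blast
  have "N \<in> null_sets lebesgue" using N negligible_iff_null_sets by blast
  from AE_not_in[OF this] have "AE y in lebesgue. y \<in> V \<longrightarrow> w y = c"
    by eventually_elim (use c in blast)
  then show ?thesis by blast
qed

section \<open>Essentially bounded forms and their currents\<close>

text \<open>
  Each coefficient is changed on a null set to a Borel function and then truncated at its
  essential bound.
\<close>

lemma Linf_form_Borel_representative:
  assumes w: "w \<in> Linf_forms V k" and V: "open V"
  obtains w' where "bounded_Borel_form w'" "\<And>y. w' y \<in> ext_power k"
    "AE y in lebesgue_on V. w y = w' y"
proof -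
  have Vm: "V \<inter> space lebesgue \<in> sets lebesgue" using V by simp
  have "\<exists>g. g \<in> borel_measurable borel \<and> (\<exists>C. \<forall>y. \<bar>g y\<bar> \<le> C) \<and> (AE y in lebesgue_on V. w y $ I = g y)" for I
  proof -
    obtain C where C: "AE y in lebesgue_on V. \<bar>w y $ I\<bar> \<le> C" and m: "(\<lambda>y. w y $ I) \<in> borel_measurable (lebesgue_on V)"
      using w by (auto simp: Linf_forms_def)
    have "(\<lambda>y. if y \<in> V then w y $ I else 0) \<in> borel_measurable lebesgue"
      using m V by (simp add: borel_measurable_if)
    from completion_ex_borel_measurable_real[OF this]
    obtain g where g: "g \<in> borel_measurable borel" "AE y in lborel. (if y \<in> V then w y $ I else 0) = g y"
      by auto
    have "AE y in lebesgue_on V. w y $ I = g y"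
      using AE_completion[OF g(2)] unfolding AE_restrict_space_iff[OF Vm] by eventually_elim auto
    with C have "AE y in lebesgue_on V. w y $ I = max (- \<bar>C\<bar>) (min \<bar>C\<bar> (g y))"
      by eventually_elim auto
    moreover have "\<bar>max (- \<bar>C\<bar>) (min \<bar>C\<bar> (g y))\<bar> \<le> \<bar>C\<bar>" for y by auto
    moreover have "(\<lambda>y. max (- \<bar>C\<bar>) (min \<bar>C\<bar> (g y))) \<in> borel_measurable borel" using g(1) by measurable
    ultimately show ?thesis by blast
  qed
  then have "\<forall>I. \<exists>g. g \<in> borel_measurable borel \<and> (\<exists>C. \<forall>y. \<bar>g y\<bar> \<le> C) \<and> (AE y in lebesgue_on V. w y $ I = g y)"
    by blast
  from choice[OF this] obtain g where g: "\<And>I. g I \<in> borel_measurable borel" "\<And>I. \<exists>C. \<forall>y. \<bar>g I y\<bar> \<le> C"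
    "\<And>I. AE y in lebesgue_on V. w y $ I = g I y"
    by blast
  define w' where "w' y = (\<chi> I. if card I = k then g I y else 0)" for y
  have "bounded_Borel_form w'"
    unfolding bounded_Borel_form_def w'_def
  proof (intro allI conjI)
    fix I
    show "(\<lambda>x. (\<chi> I. if card I = k then g I x else 0) $ I) \<in> borel_measurable borel"
      using g(1)[of I] by (cases "card I = k") auto
    show "\<exists>C. \<forall>x. \<bar>(\<chi> I. if card I = k then g I x else 0) $ I\<bar> \<le> C"
      using g(2)[of I] by (cases "card I = k") auto
  qed
  moreover have "w' y \<in> ext_power k" for y by (simp add: w'_def ext_power_def)
  moreover have "AE y in lebesgue_on V. \<forall>I. w y $ I = g I y"
    using g(3) by (simp add: AE_all_countable)
  moreover have "AE y in lebesgue_on V. w y \<in> ext_power k" using w by (simp add: Linf_forms_def)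
  ultimately have "AE y in lebesgue_on V. w y = w' y"
    by (elim AE_mp, intro AE_I2) (auto simp: w'_def ext_power_def vec_eq_iff)
  then show ?thesis using that \<open>bounded_Borel_form w'\<close> \<open>\<And>y. w' y \<in> ext_power k\<close> by blast
qed

lemma form_current_eq_lborel_integral:
  assumes V: "open V" and w: "\<And>I. (\<lambda>x. w x $ I) \<in> borel_measurable (lebesgue_on V)"
    and w': "\<And>I. (\<lambda>x. w' x $ I) \<in> borel_measurable borel" "AE y in lebesgue_on V. w y = w' y"
    and u: "compact_support_form u" "\<And>x. x \<notin> V \<Longrightarrow> u x = 0"
  shows "form_current V w u = (\<integral>x. wedge (w' x) (u x) $ UNIV \<partial>lborel)"
proof -
  have uc: "(\<lambda>x. u x $ I) \<in> borel_measurable borel" for I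
    using u(1) by (auto simp: compact_support_form_def intro: borel_measurable_continuous_onI)
  have um: "(\<lambda>x. u x $ I) \<in> borel_measurable (lebesgue_on V)" for I
    using uc[of I] by (intro measurable_restrict_space1 measurable_completion) simp
  have F'm: "(\<lambda>x. wedge (w' x) (u x) $ UNIV) \<in> borel_measurable borel"
    unfolding wedge_UNIV by (intro borel_measurable_sum borel_measurable_times borel_measurable_const w' uc)
  have "form_current V w u = (\<integral>x. wedge (w x) (u x) $ UNIV \<partial>lebesgue_on V)"
    by (simp add: form_current_def form_integral_def)
  also have "\<dots> = (\<integral>x. wedge (w' x) (u x) $ UNIV \<partial>lebesgue_on V)"
  proof (rule integral_cong_AE)
    show "(\<lambda>x. wedge (w x) (u x) $ UNIV) \<in> borel_measurable (lebesgue_on V)"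
      unfolding wedge_UNIV by (intro borel_measurable_sum borel_measurable_times borel_measurable_const w um)
    show "(\<lambda>x. wedge (w' x) (u x) $ UNIV) \<in> borel_measurable (lebesgue_on V)"
      using F'm by (intro measurable_restrict_space1 measurable_completion) simp
    show "AE x in lebesgue_on V. wedge (w x) (u x) $ UNIV = wedge (w' x) (u x) $ UNIV"
      using w'(2) by eventually_elim simp
  qed
  also have "\<dots> = (\<integral>x. indicator V x *\<^sub>R wedge (w' x) (u x) $ UNIV \<partial>lebesgue)"
    using V by (subst integral_restrict_space) auto
  also have "(\<lambda>x. indicator V x *\<^sub>R wedge (w' x) (u x) $ UNIV) = (\<lambda>x. wedge (w' x) (u x) $ UNIV)"
    using u(2) by (auto simp: fun_eq_iff indicator_def wedge_UNIV)
  also have "(\<integral>x. wedge (w' x) (u x) $ UNIV \<partial>lebesgue) = (\<integral>x. wedge (w' x) (u x) $ UNIV \<partial>lborel)"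
    using F'm by (intro integral_completion) simp
  finally show ?thesis .
qed

lemma test_forms_outside:
  assumes \<alpha>: "\<alpha> \<in> test_forms V j" and x: "x \<notin> V"
  shows "\<alpha> x = 0" "ext_deriv \<alpha> x = 0"
proof -
  have n: "x \<notin> closure {x. \<alpha> x \<noteq> 0}" using assms by (auto simp: test_forms_def)
  then show "\<alpha> x = 0" using closure_subset[of "{x. \<alpha> x \<noteq> 0}"] by blast
  show "ext_deriv \<alpha> x = 0"
    by (simp add: vec_eq_iff ext_deriv_component partial_deriv_eq_0_outside_support[OF n])
qed

lemma has_weak_diff_0_imp_closed_on:
  assumes V: "open V" and w: "w \<in> Linf_forms V k" and d: "has_weak_diff V k w (\<lambda>_. 0)"
    and w': "bounded_Borel_form w'" "AE y in lebesgue_on V. w y = w' y"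
  shows "closed_on V k w'"
  unfolding closed_on_def
proof (intro allI impI)
  fix j \<gamma> assume j: "j + (k + 1) = CARD('a)" and \<gamma>: "\<gamma> \<in> test_forms V j"
  have "form_current V (\<lambda>_. 0) \<gamma> = 0"
    by (simp add: form_current_def form_integral_def wedge_UNIV)
  moreover have "current_diff k (form_current V w) \<gamma> = form_current V (\<lambda>_. 0) \<gamma>"
    using d j \<gamma> unfolding has_weak_diff_def current_eq_def by blast
  ultimately have "form_current V w (ext_deriv \<gamma>) = 0" by (simp add: current_diff_def)
  moreover have "form_current V w (ext_deriv \<gamma>) = (\<integral>y. wedge (w' y) (ext_deriv \<gamma> y) $ UNIV \<partial>lborel)"
    using w w' test_forms_outside(2)[OF \<gamma>] compact_support_ext_deriv[OF test_formsD[OF \<gamma>]]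
    by (intro form_current_eq_lborel_integral[OF V]) (auto simp: Linf_forms_def bounded_Borel_form_def)
  ultimately show "(\<integral>y. wedge (w' y) (ext_deriv \<gamma> y) $ UNIV \<partial>lborel) = 0" by simp
qed

text \<open>
  Boundedness of \<open>V\<close> makes the radial field and hence \<open>\<theta>\<close> bounded
  on \<open>V\<close>; a closed form need not have a bounded primitive on an unbounded set.
\<close>

lemma Poincare_star_shaped:
  fixes p :: "real ^ 'n::{finite,linorder}" and w :: "'n form"
  assumes V: "open V" "bounded V" and star: "\<And>x t. x \<in> V \<Longrightarrow> 0 < t \<Longrightarrow> t \<le> 1 \<Longrightarrow> p + t *\<^sub>R (x - p) \<in> V"
    and k: "k > 0" and w: "w \<in> Linf_forms V k" and d: "has_weak_diff V k w (\<lambda>_. 0)"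
  shows "\<exists>\<theta>\<in>Linf_forms V (k - 1). has_weak_diff V (k - 1) \<theta> w"
proof -
  obtain w' where w': "bounded_Borel_form w'" "\<And>y. w' y \<in> ext_power k"
    "AE y in lebesgue_on V. w y = w' y"
    using Linf_form_Borel_representative[OF w V(1)] by blast
  have cl: "closed_on V k w'" by (rule has_weak_diff_0_imp_closed_on[OF V(1) w d w'(1,3)])
  define W where "W = cone_form p k w'"
  have W: "bounded_Borel_form W" "\<And>x. W x \<in> ext_power k"
    unfolding W_def by (intro bounded_Borel_cone_form w' cone_form_ext_power)+
  define \<theta> where "\<theta> x = interior_prod (x - p) (W x)" for x
  have \<theta>m: "(\<lambda>x. \<theta> x $ J) \<in> borel_measurable borel" for J
  proof -
    have [measurable]: "(\<lambda>x. W x $ I) \<in> borel_measurable borel" for I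
      using W(1) by (simp add: bounded_Borel_form_def)
    have [measurable]: "(\<lambda>x::(real, 'n) vec. (x - p) $ i) \<in> borel_measurable borel" for i
      by (intro borel_measurable_continuous_onI continuous_intros)
    show ?thesis unfolding \<theta>_def interior_prod_def vec_lambda_beta by measurable
  qed
  have \<theta>lm: "(\<lambda>x. \<theta> x $ J) \<in> borel_measurable (lebesgue_on V)" for J
    using \<theta>m[of J] by (intro measurable_restrict_space1 measurable_completion) simp
  obtain R where R: "\<And>x. x \<in> V \<Longrightarrow> norm (x - p) \<le> R"
    using bounded_subset_ballD[OF V(2), of p]
    by (metis dist_commute dist_norm less_imp_le mem_ball subset_iff)
  obtain C where C: "\<And>I x. \<bar>W x $ I\<bar> \<le> C I"
    using W(1) unfolding bounded_Borel_form_def by metis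
  have "\<bar>\<theta> x $ J\<bar> \<le> (\<Sum>i\<in>- J. R * C (insert i J))" if "x \<in> V" for x J
  proof -
    have "\<bar>\<theta> x $ J\<bar> \<le> (\<Sum>i\<in>- J. \<bar>wedge_sign {i} J * (x - p) $ i * W x $ insert i J\<bar>)"
      unfolding \<theta>_def interior_prod_def vec_lambda_beta by (rule sum_abs)
    also have "\<dots> \<le> (\<Sum>i\<in>- J. R * C (insert i J))"
    proof (rule sum_mono)
      fix i
      have "\<bar>wedge_sign {i} J\<bar> = 1" by (simp add: wedge_sign_def)
      moreover have "\<bar>(x - p) $ i\<bar> * \<bar>W x $ insert i J\<bar> \<le> R * C (insert i J)"
        using order_trans[OF component_le_norm_cart R[OF that], of i] C[of x "insert i J"] by (intro mult_mono) auto
      ultimately show "\<bar>wedge_sign {i} J * (x - p) $ i * W x $ insert i J\<bar> \<le> R * C (insert i J)"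
        by (simp add: abs_mult)
    qed
    finally show ?thesis .
  qed
  then have \<theta>b: "\<exists>C. AE x in lebesgue_on V. \<bar>\<theta> x $ J\<bar> \<le> C" for J
    using V(1) by (intro exI AE_I2) auto
  have "\<theta> x \<in> ext_power (k - 1)" for x
    unfolding \<theta>_def by (intro interior_prod_ext_power W)
  then have "\<theta> \<in> Linf_forms V (k - 1)"
    using \<theta>lm \<theta>b by (simp add: Linf_forms_def)
  moreover have "has_weak_diff V (k - 1) \<theta> w"
    unfolding has_weak_diff_def current_eq_def
  proof (intro allI impI)
    fix j \<alpha> assume j: "j + (k - 1 + 1) = CARD('n)" and \<alpha>: "\<alpha> \<in> test_forms V j"
    have n: "j + k = CARD('n)" using j k by simp
    have "form_current V \<theta> (ext_deriv \<alpha>) = (\<integral>x. wedge (\<theta> x) (ext_deriv \<alpha> x) $ UNIV \<partial>lborel)"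
      by (intro form_current_eq_lborel_integral[OF V(1)] \<theta>m \<theta>lm compact_support_ext_deriv
        test_formsD[OF \<alpha>] test_forms_outside(2)[OF \<alpha>]) auto
    also have "\<dots> = (- 1) ^ k * (\<integral>y. wedge (w' y) (\<alpha> y) $ UNIV \<partial>lborel)"
      unfolding \<theta>_def W_def by (rule cone_primitive[OF w'(1,2) k cl star \<alpha> n])
    also have "(\<integral>y. wedge (w' y) (\<alpha> y) $ UNIV \<partial>lborel) = form_current V w \<alpha>"
      using w w' test_forms_outside(1)[OF \<alpha>] compact_support_smooth[OF test_formsD[OF \<alpha>]]
      by (intro form_current_eq_lborel_integral[OF V(1), symmetric]) (auto simp: Linf_forms_def bounded_Borel_form_def)
    finally have "form_current V \<theta> (ext_deriv \<alpha>) = (- 1) ^ k * form_current V w \<alpha>" .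
    moreover have "(- 1::real) ^ k * ((- 1) ^ k * c) = c" for c
      by (simp flip: mult.assoc power_mult_distrib)
    ultimately show "current_diff (k - 1) (form_current V \<theta>) \<alpha> = form_current V w \<alpha>"
      using k by (simp add: current_diff_def)
  qed
  ultimately show ?thesis by blast
qed

lemma weakly_closed_zero_form_locally_constant:
  fixes p :: "real ^ 'n::{finite,linorder}" and w :: "'n form"
  defines "V \<equiv> box (p - One) (p + One)"
  assumes w: "w \<in> Linf_forms V 0" and d: "has_weak_diff V 0 w (\<lambda>_. 0)"
  shows "\<exists>g. locally_constant_on g V \<and> (AE y in lebesgue_on V. w y = g y)"
proof -
  have V: "open V" unfolding V_def by (rule open_box)
  obtain w' where w': "bounded_Borel_form w'" "\<And>y. w' y \<in> ext_power 0"
    "AE y in lebesgue_on V. w y = w' y"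
    using Linf_form_Borel_representative[OF w V] by blast
  obtain c where "AE y in lebesgue. y \<in> V \<longrightarrow> w' y = c"
    using closed_zero_form_constant[OF w'(1,2), of p] has_weak_diff_0_imp_closed_on[OF V w d w'(1,3)]
    unfolding V_def by blast
  then have "AE y in lebesgue_on V. w' y = c"
    using V by (subst AE_restrict_space_iff) auto
  with w'(3) have "AE y in lebesgue_on V. w y = c" by eventually_elim simp
  moreover have "locally_constant_on (\<lambda>_. c) V"
    using V by (auto simp: locally_constant_on_def constant_on_def)
  ultimately show ?thesis by (intro exI[of _ "\<lambda>_. c"]) simp
qed

theorem lemma4p3:
  fixes x :: "real ^ 'n::{finite,linorder}"
  shows "\<exists>V. open V \<and> x \<in> V \<and>
    (\<forall>k>0. \<forall>w\<in>Linf_forms V k. has_weak_diff V k w (\<lambda>_. 0) \<longrightarrow>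
       (\<exists>\<theta>\<in>Linf_forms V (k - 1). has_weak_diff V (k - 1) \<theta> w)) \<and>
    (\<forall>w\<in>Linf_forms V 0. has_weak_diff V 0 w (\<lambda>_. 0) \<longrightarrow>
       (\<exists>g. locally_constant_on g V \<and> (AE y in lebesgue_on V. w y = g y)))"
proof (intro exI[of _ "box (x - One) (x + One)"] conjI ballI allI impI)
  let ?V = "box (x - One) (x + One)"
  show xV: "x \<in> ?V" by (simp add: mem_box_cart One_eq_vec)
  have star: "x + t *\<^sub>R (y - x) \<in> ?V" if "y \<in> ?V" "0 < t" "t \<le> 1" for y t
    using convexD_alt[OF convex_box(2) xV that(1), of t] that by (simp add: algebra_simps)
  show "\<exists>\<theta>\<in>Linf_forms ?V (k - 1). has_weak_diff ?V (k - 1) \<theta> w"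
    if "k > 0" "w \<in> Linf_forms ?V k" "has_weak_diff ?V k w (\<lambda>_. 0)" for k w
    by (rule Poincare_star_shaped[OF open_box bounded_box star that])
qed (simp_all add: weakly_closed_zero_form_locally_constant open_box)

end
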